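(* Let $G$ be a connected simple outerplanar graph on $n$ vertices. Then $\operatorname{sn}(G)\le (2+\sqrt{2})\sqrt{n}+4$, where $\operatorname{sn}(G)$ denotes the scramble number of $G$.
   Context: All graphs are finite and simple. A planar graph is outerplanar if it can be embedded in the plane (drawn with no crossing edges) so that all of its vertices lie on the unbounded face. Scramble number. A scramble $\mathcal{S}=\{\mathcal{E}_1,\dots,\mathcal{E}_m\}$ on a graph $G$ is a collection of (nonempty) connected subgraphs of $G$, called eggs. A hitting set for $\mathcal{S}$ is a set of vertices of $G$ having nonempty intersection with each egg; the hitting size $h(\mathcal{S})$ is the minimum size of a hitting set. An egg-cut for $\mathcal{S}$ is a set of edges $C(A,B)=\{e\in E(G) : e=\{a,b\},\ a\in A,\ b\in B\}$, where $V(G)=A\sqcup B$ and at least one egg has all its vertices in $A$ and at least one egg has all its vertices in $B$. The egg-cut size $e(\mathcal{S})$ is the minimum number of edges in an egg-cut, with $e(\mathcal{S})=\infty$ if there is no egg-cut. The order of $\mathcal{S}$ is $\|\mathcal{S}\|=\min\{h(\mathcal{S}),e(\mathcal{S})\}$, and $\operatorname{sn}(G)$ is the maximum of $\|\mathcal{S}\|$ over all scrambles $\mathcal{S}$ on $G$. *)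

theory Defs
  imports "HOL-Analysis.Analysis" "HOL-Library.Extended_Nat" "Graph_Theory.Graph_Theory"
begin

text \<open>
  A finite simple graph is a pair digraph satisfying the locale predicate \<open>pair_graph\<close>: finite,
  loop-free and with a symmetric arc set. Each undirected edge is thus a pair of opposite arcs;
  \<open>edges\<close> identifies the two. The name \<open>connected\<close> is always qualified, as the
  topological notion has the same base name.
\<close>

definition edges :: "'a pair_pre_digraph \<Rightarrow> 'a set set" where
  "edges G = {{u, v} | u v. (u, v) \<in> parcs G}"

subsection \<open>Outerplanar graphs\<close>

definition drawing_in_plane ::
    "'a pair_pre_digraph \<Rightarrow> ('a \<Rightarrow> complex) \<Rightarrow> ('a set \<Rightarrow> real \<Rightarrow> complex) \<Rightarrow> bool" where
  "drawing_in_plane G p c \<longleftrightarrow>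
     inj_on p (pverts G) \<and>
     (\<forall>e\<in>edges G. arc (c e) \<and> {pathstart (c e), pathfinish (c e)} = p ` e) \<and>
     (\<forall>e\<in>edges G. \<forall>v\<in>pverts G. p v \<in> path_image (c e) \<longrightarrow> v \<in> e) \<and>
     (\<forall>e\<in>edges G. \<forall>f\<in>edges G. e \<noteq> f \<longrightarrow>
        path_image (c e) \<inter> path_image (c f) \<subseteq> p ` (e \<inter> f))"

definition drawing_image ::
    "'a pair_pre_digraph \<Rightarrow> ('a \<Rightarrow> complex) \<Rightarrow> ('a set \<Rightarrow> real \<Rightarrow> complex) \<Rightarrow> complex set" where
  "drawing_image G p c = p ` pverts G \<union> (\<Union>e\<in>edges G. path_image (c e))"

text \<open>
  For a finite graph the image of a drawing is compact, so that \<open>outside (drawing_image G p c)\<close>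
  is connected: it is the unbounded face, an open set. A vertex lies on the face if it
  lies on its boundary.
\<close>

definition outerplanar :: "'a pair_pre_digraph \<Rightarrow> bool" where
  "outerplanar G \<longleftrightarrow>
     (\<exists>p c. drawing_in_plane G p c \<and> p ` pverts G \<subseteq> frontier (outside (drawing_image G p c)))"

subsection \<open>Scramble number\<close>

text \<open>The library's \<open>connected\<close> includes that the vertex set is nonempty.\<close>

definition egg :: "'a pair_pre_digraph \<Rightarrow> 'a pair_pre_digraph \<Rightarrow> bool" where
  "egg G H \<longleftrightarrow> pair_graph H \<and> subgraph (with_proj H) (with_proj G) \<and>
     Digraph_Component.connected (with_proj H)"

definition scramble :: "'a pair_pre_digraph \<Rightarrow> 'a pair_pre_digraph set \<Rightarrow> bool" where
  "scramble G S \<longleftrightarrow> (\<forall>H\<in>S. egg G H)"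

definition hitting_set :: "'a pair_pre_digraph \<Rightarrow> 'a pair_pre_digraph set \<Rightarrow> 'a set \<Rightarrow> bool" where
  "hitting_set G S X \<longleftrightarrow> X \<subseteq> pverts G \<and> (\<forall>H\<in>S. X \<inter> pverts H \<noteq> {})"

definition hitting_size :: "'a pair_pre_digraph \<Rightarrow> 'a pair_pre_digraph set \<Rightarrow> nat" where
  "hitting_size G S = Min (card ` {X. hitting_set G S X})"

definition edge_cut :: "'a pair_pre_digraph \<Rightarrow> 'a set \<Rightarrow> 'a set \<Rightarrow> 'a set set" where
  "edge_cut G A B = {e \<in> edges G. \<exists>a\<in>A. \<exists>b\<in>B. e = {a, b}}"

definition egg_cuts :: "'a pair_pre_digraph \<Rightarrow> 'a pair_pre_digraph set \<Rightarrow> 'a set set set" where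
  "egg_cuts G S = {edge_cut G A B | A B. A \<union> B = pverts G \<and> A \<inter> B = {} \<and>
     (\<exists>H\<in>S. pverts H \<subseteq> A) \<and> (\<exists>H\<in>S. pverts H \<subseteq> B)}"

text \<open>In \<open>enat\<close> the infimum of the empty set is \<open>\<infinity>\<close>.\<close>

definition egg_cut_size :: "'a pair_pre_digraph \<Rightarrow> 'a pair_pre_digraph set \<Rightarrow> enat" where
  "egg_cut_size G S = (INF C\<in>egg_cuts G S. enat (card C))"

text \<open>The minimum is finite since the hitting size is, so that \<open>the_enat\<close> is harmless.\<close>

definition scramble_order :: "'a pair_pre_digraph \<Rightarrow> 'a pair_pre_digraph set \<Rightarrow> nat" where
  "scramble_order G S = the_enat (min (enat (hitting_size G S)) (egg_cut_size G S))"

definition scramble_number :: "'a pair_pre_digraph \<Rightarrow> nat" where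
  "scramble_number G = Max (scramble_order G ` {S. scramble G S})"

text \<open>The following facts show that the minima and the maximum above are well defined.\<close>

lemma enat_scramble_order:
  "enat (scramble_order G S) = min (enat (hitting_size G S)) (egg_cut_size G S)"
  by (cases "egg_cut_size G S") (simp_all add: scramble_order_def min_def)

lemma finite_hitting_sets:
  assumes "pair_graph G"
  shows "finite {X. hitting_set G S X}"
proof (rule finite_subset)
  show "{X. hitting_set G S X} \<subseteq> Pow (pverts G)"
    by (auto simp: hitting_set_def)
  show "finite (Pow (pverts G))"
    using assms by (simp add: pair_graph_def pair_digraph_def pair_fin_digraph.pair_finite_verts)
qed

lemma hitting_set_pverts:
  assumes "scramble G S"
  shows "hitting_set G S (pverts G)"
proof -
  have "pverts G \<inter> pverts H \<noteq> {}" if "H \<in> S" for H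
  proof -
    from assms that have "subgraph (with_proj H) (with_proj G)"
      and c: "Digraph_Component.connected (with_proj H)"
      by (auto simp: scramble_def egg_def)
    then have "pverts H \<subseteq> pverts G" by (simp add: subgraph_def)
    moreover have "pverts H \<noteq> {}"
      using c by (simp add: Digraph_Component.connected_def strongly_connected_def mk_symmetric_def)
    ultimately show ?thesis by blast
  qed
  then show ?thesis by (simp add: hitting_set_def)
qed

lemma finite_scrambles:
  assumes "pair_graph G"
  shows "finite {S. scramble G S}"
proof -
  have fin: "finite (pverts G)" "finite (parcs G)"
    using assms by (simp_all add: pair_graph_def pair_digraph_def pair_fin_digraph.pair_finite_verts
      pair_fin_digraph.pair_finite_arcs)
  let ?K = "(\<lambda>(V, E). \<lparr>pverts = V, parcs = E\<rparr>) ` (Pow (pverts G) \<times> Pow (parcs G))"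
  have "H \<in> ?K" if "egg G H" for H
  proof
    show "H = (\<lambda>(V, E). \<lparr>pverts = V, parcs = E\<rparr>) (pverts H, parcs H)" by simp
    show "(pverts H, parcs H) \<in> Pow (pverts G) \<times> Pow (parcs G)"
      using that by (auto simp: egg_def subgraph_def)
  qed
  then have "{S. scramble G S} \<subseteq> Pow ?K" by (auto simp: scramble_def simp del: image_iff)
  moreover have "finite (Pow ?K)" using fin by simp
  ultimately show ?thesis by (rule finite_subset)
qed

lemma scramble_empty: "scramble G {}"
  by (simp add: scramble_def)

end

theory Submission
  imports Defs
begin

text \<open>
  Pack eggs of a scramble that are pairwise disjoint and have no edges between them. Some such
  packing, of \<open>p\<close> eggs say, comes with at most \<open>3p\<close> vertices that hit all the eggs, so that the
  order \<open>k\<close> of the scramble is at most \<open>3p\<close>. On the other hand, for \<open>p \<ge> 2\<close> each of the packed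
  eggs is separated from the others by the set of edges that leave it. These \<open>p\<close> egg-cuts are
  pairwise disjoint and have at least \<open>k\<close> edges each, whereas an outerplanar graph has at most
  \<open>2n\<close> edges. So \<open>k\<^sup>2 \<le> 3p k \<le> 6n\<close>, and \<open>6 \<le> (2 + sqrt 2)\<^sup>2\<close>; for \<open>p \<le> 1\<close> the order is at most 3
  (\<open>scramble_order_bound\<close>).

  Packing and edge count rest on one structural fact (\<open>bond_split\<close>). Call a connected set of
  vertices a bond if its complement is empty or connected and it has at most two neighbours.
  Then every bond has a vertex whose removal leaves only bonds. Cutting off one bond after
  another gives the edge count (\<open>card_touching\<close>), and looking at a smallest bond that contains
  an egg gives the packing (\<open>hitting_packing\<close>). The structural fact itself says that two outer
  neighbours \<open>x\<close>, \<open>y\<close> of a bond are separated inside the bond by one vertex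
  (\<open>separating_vertex\<close>). If they were not, two paths from \<open>x\<close> to \<open>y\<close> through the bond and a
  third one outside would yield a subdivision of $K_{2,3}$ or of $K_4$.

  That an outerplanar drawing contains neither (\<open>no_theta\<close>, \<open>no_K4_subdivision\<close>) is a matter of
  plane topology. No closed curve of the drawing encloses a vertex, as all vertices are on the
  unbounded face. But of three arcs that have their ends and nothing else in common, one runs
  inside the curve formed by the other two; this follows from the Jordan curve theorem and
  Janiszewski's theorem (\<open>theta_third_arc_inside\<close>).
\<close>

section \<open>Thetas in the plane\<close>

lemma loop_of_arcs:
  fixes g1 g2 :: "real \<Rightarrow> complex"
  assumes "arc g1" "arc g2" "pathstart g1 = a" "pathfinish g1 = b"
    "pathstart g2 = a" "pathfinish g2 = b"
    and "path_image g1 \<inter> path_image g2 \<subseteq> {a, b}"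
  obtains c where "simple_path c" "pathfinish c = pathstart c"
    "path_image c = path_image g1 \<union> path_image g2"
proof
  let ?c = "g1 +++ reversepath g2"
  show "simple_path ?c"
    by (rule simple_path_join_loop) (use assms in \<open>auto simp: arc_reversepath\<close>)
  show "pathfinish ?c = pathstart ?c" using assms by simp
  show "path_image ?c = path_image g1 \<union> path_image g2" using assms by (simp add: path_image_join)
qed

lemma inside_of_arcs:
  fixes g1 g2 :: "real \<Rightarrow> complex"
  assumes "arc g1" "arc g2" "pathstart g1 = a" "pathfinish g1 = b"
    "pathstart g2 = a" "pathfinish g2 = b"
    and "path_image g1 \<inter> path_image g2 \<subseteq> {a, b}"
  defines "Z \<equiv> path_image g1 \<union> path_image g2"
  shows "inside Z \<noteq> {}" "topological_space_class.connected (inside Z)"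
    "topological_space_class.connected (outside Z)" "frontier (inside Z) = Z" "compact Z"
proof -
  obtain c where c: "simple_path c" "pathfinish c = pathstart c" "path_image c = Z"
    using loop_of_arcs[OF assms(1-7)] unfolding Z_def by metis
  from Jordan_inside_outside[OF c(1,2)] c(3)
  show "inside Z \<noteq> {}" "topological_space_class.connected (inside Z)"
    "topological_space_class.connected (outside Z)" "frontier (inside Z) = Z" by auto
  show "compact Z" using c compact_simple_path_image by blast
qed

lemma connected_off_curve:
  fixes S Z :: "complex set"
  assumes "topological_space_class.connected S" "S \<inter> Z = {}" "closed Z"
  shows "S \<subseteq> inside Z \<or> S \<subseteq> outside Z"
proof -
  have "open (inside Z)" "open (outside Z)" using assms(3) by (auto simp: open_inside open_outside)
  moreover have "S \<subseteq> inside Z \<union> outside Z" using assms(2) by auto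
  moreover have "inside Z \<inter> outside Z \<inter> S = {}" by auto
  ultimately show ?thesis using connectedD[OF assms(1), of "inside Z" "outside Z"] by blast
qed

text \<open>
  Janiszewski's theorem for a point \<open>z\<close> and a point far out: the first of these is separated
  from the second by neither set, since they lie in the same connected outer region, hence not
  by the union.
\<close>

lemma outside_Un:
  fixes S T :: "complex set"
  assumes "compact S" "compact T" "topological_space_class.connected (S \<inter> T)"
    and "topological_space_class.connected (outside S)"
    and "topological_space_class.connected (outside T)"
    and "z \<in> outside S" "z \<in> outside T"
  shows "z \<in> outside (S \<union> T)"
proof -
  have "bounded (S \<union> T)" using assms by (auto intro: compact_imp_bounded)
  then obtain w where w: "w \<in> outside (S \<union> T)" using outside_bounded_nonempty by blast
  have wS: "w \<in> outside S" "w \<in> outside T"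
    using w outside_mono[of S "S \<union> T"] outside_mono[of T "S \<union> T"] by auto
  have "connected_component (- S) z w"
    unfolding connected_component_def using assms(4,6) wS outside_no_overlap[of S]
    by (intro exI[of _ "outside S"]) blast
  moreover have "connected_component (- T) z w"
    unfolding connected_component_def using assms(5,7) wS outside_no_overlap[of T]
    by (intro exI[of _ "outside T"]) blast
  ultimately have "connected_component (- (S \<union> T)) z w"
    using Janiszewski[of S T z w] assms by (auto intro: compact_imp_closed)
  then show ?thesis using w outside_same_component by (metis connected_component_sym)
qed

text \<open>
  Three arcs with only their ends in common divide the plane into three regions, and one of the
  arcs lies in the interior of the curve formed by the other two. Here \<open>u\<close> and \<open>v\<close> certify that
  this arc is neither \<open>P\<close> nor \<open>Q\<close>. To see that it is \<open>R\<close>, take a point \<open>z\<close> inside \<open>Q \<union> R\<close>, a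
  region that \<open>P\<close> does not enter. If \<open>z\<close> were outside both \<open>P \<union> Q\<close> and \<open>P \<union> R\<close>, whose
  intersection \<open>P\<close> is connected, it would be outside their union. So one of these two curves
  encloses \<open>z\<close>, hence the whole region inside \<open>Q \<union> R\<close>, hence the arc in the boundary of that
  region which is not part of the curve; this cannot be \<open>Q\<close>.
\<close>

lemma theta_third_arc_inside:
  fixes P Q R :: "real \<Rightarrow> complex"
  assumes arcs: "arc P" "arc Q" "arc R"
    and ends: "pathstart P = a" "pathfinish P = b" "pathstart Q = a" "pathfinish Q = b"
      "pathstart R = a" "pathfinish R = b"
    and disj: "path_image P \<inter> path_image Q \<subseteq> {a, b}" "path_image P \<inter> path_image R \<subseteq> {a, b}"
      "path_image Q \<inter> path_image R \<subseteq> {a, b}"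
    and u: "u \<in> path_image P - {a, b}" "u \<notin> inside (path_image Q \<union> path_image R)"
    and v: "v \<in> path_image Q - {a, b}" "v \<notin> inside (path_image P \<union> path_image R)"
  shows "path_image R - {a, b} \<subseteq> inside (path_image P \<union> path_image Q)"
proof -
  let ?P = "path_image P" and ?Q = "path_image Q" and ?R = "path_image R"
  note PQ = inside_of_arcs[OF arcs(1,2) ends(1,2,3,4) disj(1)]
  note PR = inside_of_arcs[OF arcs(1,3) ends(1,2,5,6) disj(2)]
  note QR = inside_of_arcs[OF arcs(2,3) ends(3,4,5,6) disj(3)]
  have conn: "topological_space_class.connected (?P - {a, b})"
    "topological_space_class.connected (?Q - {a, b})"
    using connected_simple_path_endless arcs ends arc_imp_simple_path by metis+
  have Pend: "a \<in> ?P" "b \<in> ?P" "a \<in> ?Q" "b \<in> ?Q" "a \<in> ?R" "b \<in> ?R"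
    using ends pathstart_in_path_image pathfinish_in_path_image by metis+
  have P_off: "?P \<inter> inside (?Q \<union> ?R) = {}"
  proof -
    have "?P - {a, b} \<subseteq> outside (?Q \<union> ?R)"
      using connected_off_curve[OF conn(1), of "?Q \<union> ?R"] QR(5) disj u
      by (auto intro: compact_imp_closed)
    then show ?thesis using Pend inside_no_overlap[of "?Q \<union> ?R"]
        inside_Int_outside[of "?Q \<union> ?R"] by blast
  qed
  have Q_off: "?Q \<inter> inside (?P \<union> ?R) = {}"
  proof -
    have "?Q - {a, b} \<subseteq> outside (?P \<union> ?R)"
      using connected_off_curve[OF conn(2), of "?P \<union> ?R"] PR(5) disj v
      by (auto intro: compact_imp_closed)
    then show ?thesis using Pend inside_no_overlap[of "?P \<union> ?R"]
        inside_Int_outside[of "?P \<union> ?R"] by blast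
  qed
  obtain z where z: "z \<in> inside (?Q \<union> ?R)" using QR(1) by blast
  have off: "inside (?Q \<union> ?R) \<inter> (?P \<union> ?Q) = {}" "inside (?Q \<union> ?R) \<inter> (?P \<union> ?R) = {}"
    using P_off inside_no_overlap[of "?Q \<union> ?R"] by blast+
  have z_off: "z \<notin> ?P \<union> ?Q \<union> ?R" using z P_off inside_no_overlap by blast
  \<comment> \<open>A curve \<open>S\<close> of the theta that encloses \<open>z\<close> encloses the region around \<open>z\<close> with its boundary.\<close>
  have absorb: "T - (S \<union> {a, b}) \<subseteq> inside S"
    if "z \<in> inside S" "closed S" "inside (?Q \<union> ?R) \<inter> S = {}" "T \<subseteq> ?Q \<union> ?R" for S T
  proof -
    have "inside (?Q \<union> ?R) \<subseteq> inside S"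
      using connected_off_curve[OF QR(2) that(3,2)] that(1) z inside_Int_outside[of S] by blast
    then have "closure (inside (?Q \<union> ?R)) \<subseteq> closure (inside S)" by (rule closure_mono)
    moreover have "?Q \<union> ?R \<subseteq> closure (inside (?Q \<union> ?R))" using QR(4) by (auto simp: frontier_def)
    moreover have "closure (inside S) \<subseteq> S \<union> inside S"
      using closure_inside_subset[OF that(2)] by (simp add: Un_commute)
    ultimately show ?thesis using that(4) by blast
  qed
  consider "z \<in> inside (?P \<union> ?Q)" | "z \<in> inside (?P \<union> ?R)"
    | "z \<in> outside (?P \<union> ?Q)" "z \<in> outside (?P \<union> ?R)"
    using z_off inside_Un_outside[of "?P \<union> ?Q"] inside_Un_outside[of "?P \<union> ?R"] by blast
  then show ?thesis
  proof cases
    case 1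
    have "?R - (?P \<union> ?Q \<union> {a,b}) \<subseteq> inside (?P \<union> ?Q)"
      by (rule absorb[OF 1 compact_imp_closed[OF PQ(5)] off(1) Un_upper2])
    then show ?thesis using disj by blast
  next
    case 2
    have "?Q - (?P \<union> ?R \<union> {a,b}) \<subseteq> inside (?P \<union> ?R)"
      by (rule absorb[OF 2 compact_imp_closed[OF PR(5)] off(2) Un_upper1])
    then show ?thesis using disj v by blast
  next
    case 3
    have "topological_space_class.connected ((?P \<union> ?Q) \<inter> (?P \<union> ?R))"
    proof -
      have "(?P \<union> ?Q) \<inter> (?P \<union> ?R) = ?P" using disj Pend by blast
      then show ?thesis using arcs(1) by (simp add: connected_arc_image)
    qed
    then have "z \<in> outside ((?P \<union> ?Q) \<union> (?P \<union> ?R))"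
      using outside_Un PQ(3,5) PR(3,5) 3 by blast
    moreover have "?Q \<union> ?R \<subseteq> (?P \<union> ?Q) \<union> (?P \<union> ?R)" by auto
    ultimately have "z \<in> outside (?Q \<union> ?R)" using outside_mono by (meson subsetD)
    then have False using z inside_Int_outside[of "?Q \<union> ?R"] by blast
    then show ?thesis ..
  qed
qed

lemma connected_arc_minus_start:
  fixes g :: "real \<Rightarrow> complex"
  assumes "arc g"
  shows "topological_space_class.connected (path_image g - {pathstart g})"
proof -
  have "path_image g - {pathstart g} = g ` {0<..1}"
    using assms unfolding arc_def path_image_def pathstart_def inj_on_def
    by (force simp: less_le)
  moreover have "continuous_on {0<..1} g"
    using assms by (auto simp: arc_def path_def intro: continuous_on_subset)
  ultimately show ?thesis using connected_continuous_image[of "{0<..1}" g] by simp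
qed

lemma connected_arc_minus_finish:
  fixes g :: "real \<Rightarrow> complex"
  assumes "arc g"
  shows "topological_space_class.connected (path_image g - {pathfinish g})"
  using connected_arc_minus_start[of "reversepath g"] assms by (simp add: arc_reversepath)

section \<open>Paths of a graph\<close>

fun path_edges :: "'a list \<Rightarrow> 'a set set" where
  "path_edges (u # v # vs) = insert {u, v} (path_edges (v # vs))"
| "path_edges _ = {}"

definition graph_path :: "'a rel \<Rightarrow> 'a \<Rightarrow> 'a list \<Rightarrow> 'a \<Rightarrow> bool" where
  "graph_path E a vs b \<longleftrightarrow> vs \<noteq> [] \<and> hd vs = a \<and> last vs = b \<and> distinct vs \<and>
     successively (\<lambda>u v. (u, v) \<in> E) vs"

lemma path_edges_subset: "e \<in> path_edges vs \<Longrightarrow> e \<subseteq> set vs"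
  by (induction vs rule: path_edges.induct) auto

lemma path_edges_join: "path_edges (us @ v # ws) = path_edges (us @ [v]) \<union> path_edges (v # ws)"
proof (induction us)
  case (Cons u us)
  then show ?case by (cases us) auto
qed simp

lemma path_edges_rev: "path_edges (rev vs) = path_edges vs"
proof (induction vs rule: path_edges.induct)
  case (1 u v vs)
  have "path_edges (rev (u # v # vs)) = path_edges (rev vs @ [v]) \<union> path_edges [v, u]"
    using path_edges_join[of "rev vs" v "[u]"] by simp
  then show ?case using 1 by (auto simp: insert_commute)
qed simp_all

lemma graph_path_ends: "graph_path E a vs b \<Longrightarrow> a \<in> set vs" "graph_path E a vs b \<Longrightarrow> b \<in> set vs"
  by (auto simp: graph_path_def)

lemma graph_path_rev:
  assumes "graph_path E a vs b" "sym E"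
  shows "graph_path E b (rev vs) a"
proof -
  have "successively (\<lambda>x y. (y, x) \<in> E) vs"
    by (rule successively_mono[of "\<lambda>u v. (u, v) \<in> E"])
      (use assms in \<open>auto simp: graph_path_def dest: symD\<close>)
  then show ?thesis using assms(1) by (simp add: graph_path_def hd_rev last_rev)
qed

lemma graph_path_split:
  assumes "graph_path E a (us @ v # ws) b"
  shows "graph_path E a (us @ [v]) v" "graph_path E v (v # ws) b"
  using assms by (auto simp: graph_path_def successively_append_iff hd_append split: if_splits)

lemma graph_path_join:
  assumes "graph_path E a us b" "graph_path E b vs c" "set us \<inter> set vs \<subseteq> {b}"
  shows "graph_path E a (us @ tl vs) c"
proof (cases vs)
  case (Cons v ws)
  have v: "v = b" "v = last us" using assms Cons by (auto simp: graph_path_def)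
  have "set us \<inter> set ws = {}" using assms Cons by (auto simp: graph_path_def)
  then show ?thesis using assms v Cons
    by (auto simp: graph_path_def successively_append_iff successively_Cons)
qed (use assms in \<open>simp add: graph_path_def\<close>)

lemma set_join:
  assumes "graph_path E a us b" "graph_path E b vs c"
  shows "set (us @ tl vs) = set us \<union> set vs"
  using assms by (cases vs) (auto simp: graph_path_def)

lemma path_edges_join_tl:
  assumes "graph_path E a us b" "graph_path E b vs c"
  shows "path_edges (us @ tl vs) = path_edges us \<union> path_edges vs"
proof -
  obtain ws us' where "vs = b # ws" "us = us' @ [b]"
    using assms unfolding graph_path_def by (metis append_butlast_last_id list.collapse)
  then show ?thesis using path_edges_join[of us' b ws] by simp
qed

text \<open>
  Paths that meet in their two ends only can still have the edge between these ends in common;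
  an interior vertex excludes this.
\<close>

lemma end_edge_notin_path_edges:
  assumes "graph_path E a vs b" "u \<in> set vs" "u \<noteq> a" "u \<noteq> b"
  shows "{a, b} \<notin> path_edges vs"
proof
  assume e: "{a, b} \<in> path_edges vs"
  then obtain v ws where vs: "vs = a # v # ws"
    using assms(1) by (cases vs rule: path_edges.cases) (auto simp: graph_path_def)
  have "{a, b} \<notin> path_edges (v # ws)"
    using path_edges_subset[of "{a, b}" "v # ws"] assms(1) vs by (auto simp: graph_path_def)
  then have "v = b" using e vs assms(1) by (auto simp: doubleton_eq_iff)
  then have "ws = []" using assms(1) vs by (cases ws) (auto simp: graph_path_def split: if_splits)
  then show False using vs assms \<open>v = b\<close> by auto
qed

section \<open>Subgraphs excluded by an outerplanar drawing\<close>

locale outer_drawing =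
  fixes G :: "'a pair_pre_digraph" and p :: "'a \<Rightarrow> complex" and c :: "'a set \<Rightarrow> real \<Rightarrow> complex"
  assumes graph: "pair_graph G"
    and drawing: "drawing_in_plane G p c"
    and outer: "p ` pverts G \<subseteq> frontier (outside (drawing_image G p c))"
begin

abbreviation "V \<equiv> pverts G"
abbreviation "E \<equiv> parcs G"

definition drawn :: "'a list \<Rightarrow> complex set" where
  "drawn vs = p ` set vs \<union> (\<Union>e\<in>path_edges vs. path_image (c e))"

lemma arcs_in_verts: "(u, v) \<in> E \<Longrightarrow> u \<in> V" "(u, v) \<in> E \<Longrightarrow> v \<in> V"
  and no_loop: "(u, u) \<notin> E"
  and sym_E: "sym E"
proof -
  interpret pair_graph G by (rule graph)
  show "(u, v) \<in> E \<Longrightarrow> u \<in> V" "(u, v) \<in> E \<Longrightarrow> v \<in> V" by (auto dest: wellformed')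
  show "(u, u) \<notin> E" using pair_no_loops by fastforce
  show "sym E" using pair_sym_arcs by (simp add: symmetric_def)
qed

lemma inj_p: "inj_on p V" using drawing by (simp add: drawing_in_plane_def)

lemma edge_arc: "e \<in> edges G \<Longrightarrow> arc (c e)"
  and edge_ends: "e \<in> edges G \<Longrightarrow> {pathstart (c e), pathfinish (c e)} = p ` e"
  and vertex_on_edge: "e \<in> edges G \<Longrightarrow> v \<in> V \<Longrightarrow> p v \<in> path_image (c e) \<Longrightarrow> v \<in> e"
  and edges_meet: "e \<in> edges G \<Longrightarrow> f \<in> edges G \<Longrightarrow> e \<noteq> f \<Longrightarrow>
    path_image (c e) \<inter> path_image (c f) \<subseteq> p ` (e \<inter> f)"
  using drawing by (simp_all add: drawing_in_plane_def)

lemma graph_path_edges: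
  assumes "graph_path E a vs b"
  shows "path_edges vs \<subseteq> edges G"
proof -
  have "path_edges vs \<subseteq> edges G" if "successively (\<lambda>u v. (u, v) \<in> E) vs" for vs
    using that by (induction vs rule: path_edges.induct) (auto simp: edges_def)
  then show ?thesis using assms by (simp add: graph_path_def)
qed

lemma drawn_in_drawing:
  assumes "graph_path E a vs b" "set vs \<subseteq> V"
  shows "drawn vs \<subseteq> drawing_image G p c"
  using assms graph_path_edges[OF assms(1)] by (auto simp: drawn_def drawing_image_def)

lemma drawn_join_tl:
  assumes "graph_path E a us b" "graph_path E b vs d"
  shows "drawn (us @ tl vs) = drawn us \<union> drawn vs"
  unfolding drawn_def set_join[OF assms] path_edges_join_tl[OF assms] by auto

lemma drawn_rev: "drawn (rev vs) = drawn vs"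
  by (simp add: drawn_def path_edges_rev)

lemma vertex_on_drawn:
  assumes "graph_path E a vs b" "set vs \<subseteq> V" "v \<in> V" "p v \<in> drawn vs"
  shows "v \<in> set vs"
proof -
  have "v \<in> e" if "e \<in> path_edges vs" "p v \<in> path_image (c e)" for e
    using that vertex_on_edge graph_path_edges[OF assms(1)] assms(3) by blast
  then have "v \<in> set vs" if "e \<in> path_edges vs" "p v \<in> path_image (c e)" for e
    using that path_edges_subset by blast
  then show ?thesis using assms inj_p by (auto simp: drawn_def inj_on_def)
qed

lemma drawn_meet:
  assumes "graph_path E a us b" "set us \<subseteq> V" "graph_path E a' vs b'" "set vs \<subseteq> V"
    and "path_edges us \<inter> path_edges vs = {}"
  shows "drawn us \<inter> drawn vs \<subseteq> p ` (set us \<inter> set vs)"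
proof
  fix z assume z: "z \<in> drawn us \<inter> drawn vs"
  consider u where "u \<in> V" "z = p u"
    | e f where "e \<in> path_edges us" "f \<in> path_edges vs" "z \<in> path_image (c e)" "z \<in> path_image (c f)"
    using z assms(2,4) unfolding drawn_def by blast
  then show "z \<in> p ` (set us \<inter> set vs)"
  proof cases
    case 1
    then have "u \<in> set us" "u \<in> set vs" using z vertex_on_drawn assms by blast+
    then show ?thesis using 1 by blast
  next
    case 2
    then have "e \<in> edges G" "f \<in> edges G" "e \<noteq> f"
      using graph_path_edges[OF assms(1)] graph_path_edges[OF assms(3)] assms(5) by auto
    then have "z \<in> p ` (e \<inter> f)" using edges_meet 2 by blast
    moreover have "e \<subseteq> set us" "f \<subseteq> set vs" using 2 path_edges_subset by blast+
    ultimately show ?thesis by blast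
  qed
qed

lemma edges_disjoint:
  assumes "graph_path E a us b" "graph_path E a' vs b'" "set us \<inter> set vs \<subseteq> {x, y}"
    and "{x, y} \<notin> path_edges us"
  shows "path_edges us \<inter> path_edges vs = {}"
proof (rule ccontr)
  assume "path_edges us \<inter> path_edges vs \<noteq> {}"
  then obtain e where e: "e \<in> path_edges us" "e \<in> path_edges vs" by blast
  then have "e \<subseteq> {x, y}" using path_edges_subset[of e] assms(3) by blast
  moreover obtain u v where "e = {u, v}" "(u, v) \<in> E"
    using e graph_path_edges[OF assms(1)] unfolding edges_def by blast
  moreover have "u \<noteq> v" using \<open>(u, v) \<in> E\<close> no_loop by auto
  ultimately have "e = {x, y}" by auto
  then show False using e assms(4) by simp
qed

lemma arc_of_graph_path:
  assumes "graph_path E a vs b" "a \<noteq> b" "set vs \<subseteq> V"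
  obtains g where "arc g" "pathstart g = p a" "pathfinish g = p b" "path_image g = drawn vs"
proof -
  have "\<exists>g. arc g \<and> pathstart g = p a \<and> pathfinish g = p b \<and> path_image g = drawn vs"
    using assms
  proof (induction vs arbitrary: a rule: path_edges.induct)
    case (1 u v vs)
    have u: "u = a" and uv: "(a, v) \<in> E" "a \<noteq> v" and a_notin: "a \<notin> set (v # vs)"
      and vs: "graph_path E v (v # vs) b"
      using 1 by (auto simp: graph_path_def successively_Cons)
    have e: "{a, v} \<in> edges G" using uv by (auto simp: edges_def)
    have edge_graph_path: "graph_path E a [a, v] v" using uv by (auto simp: graph_path_def)
    have "{pathstart (c {a, v}), pathfinish (c {a, v})} = {p a, p v}" using edge_ends[OF e] by simp
    then have "pathstart (c {a, v}) = p a \<and> pathfinish (c {a, v}) = p v \<or>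
      pathstart (c {a, v}) = p v \<and> pathfinish (c {a, v}) = p a"
      by (auto simp: doubleton_eq_iff)
    then obtain h where h: "arc h" "pathstart h = p a" "pathfinish h = p v"
      "path_image h = path_image (c {a, v})"
      using edge_arc[OF e] that
      by (metis arc_reversepath path_image_reversepath pathfinish_reversepath pathstart_reversepath)
    have "p a \<in> path_image (c {a, v})" "p v \<in> path_image (c {a, v})"
      using h pathstart_in_path_image[of h] pathfinish_in_path_image[of h] by auto
    then have drawn_edge: "drawn [a, v] = path_image h" unfolding drawn_def h by auto
    show ?case
    proof (cases "v = b")
      case True
      then have "vs = []" using vs by (cases vs) (auto simp: graph_path_def split: if_splits)
      then show ?thesis using h u True drawn_edge by metis
    next
      case False
      then obtain g where g: "arc g" "pathstart g = p v" "pathfinish g = p b"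
        "path_image g = drawn (v # vs)"
        using "1.IH"[OF vs False] 1(4) by auto
      have "path_edges [a, v] \<inter> path_edges (v # vs) = {}"
        using path_edges_subset[of "{a, v}" "v # vs"] a_notin by auto
      then have "path_image h \<inter> path_image g \<subseteq> {p v}"
        using drawn_meet[OF edge_graph_path _ vs] 1 u a_notin unfolding drawn_edge[symmetric] g by auto
      then have "arc (h +++ g)" using h g by (intro arc_join) auto
      moreover have "path_image (h +++ g) = drawn (a # v # vs)"
        using h g drawn_join_tl[OF edge_graph_path vs] drawn_edge by (simp add: path_image_join)
      ultimately show ?thesis using h g u by (intro exI[of _ "h +++ g"]) auto
    qed
  qed (auto simp: graph_path_def)
  then show ?thesis using that by blast
qed

text \<open>
  The only use of the condition on the unbounded face: this face lies outside every closed curve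
  of the drawing, and so do the limits of its points, unless they are on the curve.
\<close>

lemma vertex_not_inside:
  assumes "v \<in> V" "S \<subseteq> drawing_image G p c" "closed S"
  shows "p v \<notin> inside S"
proof
  assume v: "p v \<in> inside S"
  have "p v \<in> closure (outside (drawing_image G p c))" using assms(1) outer by (auto simp: frontier_def)
  also have "\<dots> \<subseteq> closure (outside S)" by (intro closure_mono outside_mono assms(2))
  finally have "p v \<in> closure (outside S)" .
  moreover have "inside S \<inter> closure (outside S) = {}"
    using open_Int_closure_eq_empty[OF open_inside[OF assms(3)], of "outside S"] by simp
  ultimately show False using v by blast
qed

lemma compact_drawn:
  assumes "graph_path E a vs b" "set vs \<subseteq> V"
  shows "compact (drawn vs)"
proof -
  have "finite (path_edges vs)" by (induction vs rule: path_edges.induct) auto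
  then show ?thesis unfolding drawn_def
    using graph_path_edges[OF assms(1)] edge_arc
    by (intro compact_Un compact_UN finite_imp_compact[of "p ` set vs"]) (auto intro: compact_arc_image)
qed

lemma theta_drawn:
  assumes us: "graph_path E a us b" "set us \<subseteq> V" and vs: "graph_path E a vs b" "set vs \<subseteq> V"
    and ws: "graph_path E a ws b" "set ws \<subseteq> V" and "a \<noteq> b"
    and disj: "set us \<inter> set vs \<subseteq> {a, b}" "set us \<inter> set ws \<subseteq> {a, b}" "set vs \<inter> set ws \<subseteq> {a, b}"
    and u: "u \<in> set us" "u \<noteq> a" "u \<noteq> b" and v: "v \<in> set vs" "v \<noteq> a" "v \<noteq> b"
  shows "drawn ws - {p a, p b} \<subseteq> inside (drawn us \<union> drawn vs)"
proof -
  obtain g1 where g1: "arc g1" "pathstart g1 = p a" "pathfinish g1 = p b" "path_image g1 = drawn us"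
    using arc_of_graph_path us \<open>a \<noteq> b\<close> by metis
  obtain g2 where g2: "arc g2" "pathstart g2 = p a" "pathfinish g2 = p b" "path_image g2 = drawn vs"
    using arc_of_graph_path vs \<open>a \<noteq> b\<close> by metis
  obtain g3 where g3: "arc g3" "pathstart g3 = p a" "pathfinish g3 = p b" "path_image g3 = drawn ws"
    using arc_of_graph_path ws \<open>a \<noteq> b\<close> by metis
  have ab: "{a, b} \<notin> path_edges us" "{a, b} \<notin> path_edges vs"
    using end_edge_notin_path_edges us(1) vs(1) u v by metis+
  have meet: "drawn us \<inter> drawn vs \<subseteq> {p a, p b}" "drawn us \<inter> drawn ws \<subseteq> {p a, p b}"
      "drawn vs \<inter> drawn ws \<subseteq> {p a, p b}"
    using drawn_meet[OF us vs edges_disjoint[OF us(1) vs(1) disj(1) ab(1)]]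
      drawn_meet[OF us ws edges_disjoint[OF us(1) ws(1) disj(2) ab(1)]]
      drawn_meet[OF vs ws edges_disjoint[OF vs(1) ws(1) disj(3) ab(2)]] disj by blast+
  have in_V: "a \<in> V" "b \<in> V" "u \<in> V" "v \<in> V" using us v u vs(2) graph_path_ends[OF us(1)] by auto
  have u': "p u \<in> drawn us - {p a, p b}" "p v \<in> drawn vs - {p a, p b}"
    using u v in_V inj_p by (auto simp: drawn_def inj_on_def)
  have out: "p x \<notin> inside (drawn xs \<union> drawn ws)" if "x \<in> V" "graph_path E a xs b" "set xs \<subseteq> V" for x xs
  proof (rule vertex_not_inside[OF that(1)])
    show "drawn xs \<union> drawn ws \<subseteq> drawing_image G p c" using drawn_in_drawing that ws by blast
    show "closed (drawn xs \<union> drawn ws)" using compact_drawn that ws by (meson closed_Un compact_imp_closed)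
  qed
  show ?thesis
    using theta_third_arc_inside[OF g1(1) g2(1) g3(1) g1(2,3) g2(2,3) g3(2,3), unfolded g1(4) g2(4) g3(4),
      OF meet u'(1) out[OF in_V(3) vs] u'(2) out[OF in_V(4) us]] .
qed

text \<open>
  One of the three paths would run inside the curve formed by the other two, and its interior
  vertex with it. In other words, the graph contains no subdivision of $K_{2,3}$.
\<close>

lemma no_theta:
  assumes us: "graph_path E a us b" "set us \<subseteq> V" and vs: "graph_path E a vs b" "set vs \<subseteq> V"
    and ws: "graph_path E a ws b" "set ws \<subseteq> V" and "a \<noteq> b"
    and disj: "set us \<inter> set vs \<subseteq> {a, b}" "set us \<inter> set ws \<subseteq> {a, b}" "set vs \<inter> set ws \<subseteq> {a, b}"
    and u: "u \<in> set us" "u \<noteq> a" "u \<noteq> b" and v: "v \<in> set vs" "v \<noteq> a" "v \<noteq> b"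
    and w: "w \<in> set ws" "w \<noteq> a" "w \<noteq> b"
  shows False
proof -
  have "a \<in> V" "b \<in> V" "w \<in> V" using us(2) w ws(2) graph_path_ends[OF us(1)] by auto
  then have "p w \<in> drawn ws - {p a, p b}"
    using w inj_p by (auto simp: drawn_def inj_on_def)
  then have "p w \<in> inside (drawn us \<union> drawn vs)"
    using theta_drawn[OF us vs ws \<open>a \<noteq> b\<close> disj u v] by blast
  moreover have "p w \<notin> inside (drawn us \<union> drawn vs)"
  proof (rule vertex_not_inside[OF \<open>w \<in> V\<close>])
    show "drawn us \<union> drawn vs \<subseteq> drawing_image G p c" using drawn_in_drawing us vs by blast
    show "closed (drawn us \<union> drawn vs)" using compact_drawn us vs by (meson closed_Un compact_imp_closed)
  qed
  ultimately show False by blast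
qed

text \<open>
  \<open>P\<close> and \<open>Q\<close> form a cycle, \<open>R\<close> joins its vertices \<open>x\<close> and \<open>y\<close>, and \<open>L\<close> joins \<open>u\<close> and \<open>v\<close>, which
  are separated by \<open>x\<close> and \<open>y\<close> on the cycle. On the one hand \<open>L\<close> is inside the cycle: with the
  two halves of the cycle between \<open>u\<close> and \<open>v\<close> it forms a theta, and these halves contain the
  vertices \<open>x\<close> and \<open>y\<close>. On the other hand the vertex \<open>v\<close> is outside \<open>P \<union> R\<close> and \<open>u\<close> is outside
  \<open>Q \<union> R\<close>, hence so is \<open>L\<close>, and \<open>L\<close> is outside \<open>P \<union> Q \<union> R\<close> since the intersection \<open>R\<close> of the two
  curves is connected.
\<close>

lemma no_K4_subdivision:
  assumes P: "graph_path E x (P1 @ u # P2) y" "set (P1 @ u # P2) \<subseteq> V"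
    and Q: "graph_path E x (Q1 @ v # Q2) y" "set (Q1 @ v # Q2) \<subseteq> V"
    and R: "graph_path E x R y" "set R \<subseteq> V"
    and L: "graph_path E u L v" "set L \<subseteq> V"
    and ne: "x \<noteq> y" "u \<notin> {x, y}" "v \<notin> {x, y}"
    and PQ: "set (P1 @ u # P2) \<inter> set (Q1 @ v # Q2) \<subseteq> {x, y}"
    and PR: "set (P1 @ u # P2) \<inter> set R \<subseteq> {x, y}"
    and QR: "set (Q1 @ v # Q2) \<inter> set R \<subseteq> {x, y}"
    and LP: "set L \<inter> set (P1 @ u # P2) \<subseteq> {u}"
    and LQ: "set L \<inter> set (Q1 @ v # Q2) \<subseteq> {v}"
    and LR: "set L \<inter> set R = {}"
  shows False
proof -
  define P where "P = P1 @ u # P2"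
  define Q where "Q = Q1 @ v # Q2"
  note P = P[folded P_def] and Q = Q[folded Q_def]
  note PQ = PQ[folded P_def Q_def] and PR = PR[folded P_def] and QR = QR[folded Q_def]
    and LP = LP[folded P_def] and LQ = LQ[folded Q_def]
  have uP: "u \<in> set P" and vQ: "v \<in> set Q" by (auto simp: P_def Q_def)
  have xy: "x \<in> set P" "y \<in> set P" "x \<in> set Q" "y \<in> set Q" "x \<in> set R" "y \<in> set R"
    using graph_path_ends P(1) Q(1) R(1) by metis+
  have uL: "u \<in> set L" "v \<in> set L" using graph_path_ends[OF L(1)] by auto
  have uv: "u \<noteq> v" using uP vQ PQ ne by auto
  have nend: "v \<notin> set P" "u \<notin> set Q" "u \<notin> set R" "v \<notin> set R"
    using uP vQ PQ PR QR ne by auto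
  have Lxy: "x \<notin> set L" "y \<notin> set L" using LR xy by auto
  have inV: "u \<in> V" "v \<in> V" "x \<in> V" "y \<in> V" using uP vQ P(2) Q(2) xy by auto
  \<comment> \<open>\<open>X\<close> and \<open>Y\<close> are the halves of the cycle from \<open>u\<close> to \<open>v\<close>, through \<open>x\<close> and through \<open>y\<close>.\<close>
  define Px Py Qx Qy where "Px = rev (P1 @ [u])" and "Py = u # P2"
    and "Qx = Q1 @ [v]" and "Qy = rev (v # Q2)"
  define X where "X = Px @ tl Qx"
  define Y where "Y = Py @ tl Qy"
  note defs = Px_def Py_def Qx_def Qy_def
  have Px: "graph_path E u Px x" and Py: "graph_path E u Py y"
    using graph_path_split[OF P(1)[unfolded P_def]] graph_path_rev[OF _ sym_E] unfolding defs by blast+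
  have Qx: "graph_path E x Qx v" and Qy: "graph_path E y Qy v"
    using graph_path_split[OF Q(1)[unfolded Q_def]] graph_path_rev[OF _ sym_E] unfolding defs by blast+
  have sP: "set Px \<union> set Py = set P" "set Px \<inter> set Py = {u}"
    using P(1) by (auto simp: defs P_def graph_path_def)
  have sQ: "set Qx \<union> set Qy = set Q" "set Qx \<inter> set Qy = {v}"
    using Q(1) by (auto simp: defs Q_def graph_path_def)
  have sub: "set Px \<subseteq> set P" "set Py \<subseteq> set P" "set Qx \<subseteq> set Q" "set Qy \<subseteq> set Q"
    using sP(1) sQ(1) by auto
  have xPx: "x \<in> set Px" "y \<in> set Py" "x \<in> set Qx" "y \<in> set Qy"
    using graph_path_ends Px Py Qx Qy by metis+
  have yPx: "y \<notin> set Px" "x \<notin> set Py" "y \<notin> set Qx" "x \<notin> set Qy"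
    using xPx sP(2) sQ(2) ne by auto
  have X: "graph_path E u X v" unfolding X_def
    by (rule graph_path_join[OF Px Qx]) (use sub PQ yPx in blast)
  have Y: "graph_path E u Y v" unfolding Y_def
    by (rule graph_path_join[OF Py Qy]) (use sub PQ yPx in blast)
  have sX: "set X = set Px \<union> set Qx" and sY: "set Y = set Py \<union> set Qy"
    unfolding X_def Y_def by (rule set_join[OF Px Qx], rule set_join[OF Py Qy])
  have sXV: "set X \<subseteq> V" "set Y \<subseteq> V" using sub P(2) Q(2) unfolding sX sY by blast+
  have dX: "drawn X = drawn Px \<union> drawn Qx" and dY: "drawn Y = drawn Py \<union> drawn Qy"
    unfolding X_def Y_def by (rule drawn_join_tl[OF Px Qx], rule drawn_join_tl[OF Py Qy])
  have dP: "drawn P = drawn Px \<union> drawn Py"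
  proof -
    have "P = rev Px @ tl Py" by (simp add: P_def defs)
    then show ?thesis using drawn_join_tl[OF graph_path_rev[OF Px sym_E] Py] drawn_rev by simp
  qed
  have dQ: "drawn Q = drawn Qx \<union> drawn Qy"
  proof -
    have "Q = Qx @ tl (rev Qy)" by (simp add: Q_def defs)
    then show ?thesis using drawn_join_tl[OF Qx graph_path_rev[OF Qy sym_E]] drawn_rev by simp
  qed
  have XY: "set X \<inter> set Y \<subseteq> {u, v}"
  proof -
    have "set Px \<inter> set Qy = {}" "set Qx \<inter> set Py = {}"
      using sub PQ yPx by blast+
    then show ?thesis using sP(2) sQ(2) unfolding sX sY by blast
  qed
  have XL: "set X \<inter> set L \<subseteq> {u, v}" "set Y \<inter> set L \<subseteq> {u, v}"
    using LP LQ sub unfolding sX sY by blast+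
  have L_inside: "drawn L - {p u, p v} \<subseteq> inside (drawn P \<union> drawn Q)"
  proof -
    have "drawn L - {p u, p v} \<subseteq> inside (drawn X \<union> drawn Y)"
      by (rule theta_drawn[OF X sXV(1) Y sXV(2) L uv XY XL, of x y])
        (use sX sY xPx ne in auto)
    moreover have "drawn X \<union> drawn Y = drawn P \<union> drawn Q" using dX dY dP dQ by blast
    ultimately show ?thesis by simp
  qed
  obtain gP where gP: "arc gP" "pathstart gP = p x" "pathfinish gP = p y" "path_image gP = drawn P"
    using arc_of_graph_path P ne(1) by metis
  obtain gQ where gQ: "arc gQ" "pathstart gQ = p x" "pathfinish gQ = p y" "path_image gQ = drawn Q"
    using arc_of_graph_path Q ne(1) by metis
  obtain gR where gR: "arc gR" "pathstart gR = p x" "pathfinish gR = p y" "path_image gR = drawn R"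
    using arc_of_graph_path R ne(1) by metis
  obtain gL where gL: "arc gL" "pathstart gL = p u" "pathfinish gL = p v" "path_image gL = drawn L"
    using arc_of_graph_path L uv by metis
  have xyP: "{x, y} \<notin> path_edges P" "{x, y} \<notin> path_edges Q"
    using end_edge_notin_path_edges[OF P(1) uP] end_edge_notin_path_edges[OF Q(1) vQ] ne by auto
  have single: "{w, w} \<notin> path_edges L" for w
    using graph_path_edges[OF L(1)] no_loop by (force simp: edges_def doubleton_eq_iff)
  have PR': "drawn P \<inter> drawn R \<subseteq> {p x, p y}"
    using drawn_meet[OF P R edges_disjoint[OF P(1) R(1) PR xyP(1)]] PR by blast
  have QR': "drawn Q \<inter> drawn R \<subseteq> {p x, p y}"
    using drawn_meet[OF Q R edges_disjoint[OF Q(1) R(1) QR xyP(2)]] QR by blast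
  have PQ': "drawn P \<inter> drawn Q \<subseteq> {p x, p y}"
    using drawn_meet[OF P Q edges_disjoint[OF P(1) Q(1) PQ xyP(1)]] PQ by blast
  have LP': "drawn L \<inter> drawn P \<subseteq> {p u}"
    using drawn_meet[OF L P edges_disjoint[OF L(1) P(1) _ single]] LP by blast
  have LQ': "drawn L \<inter> drawn Q \<subseteq> {p v}"
    using drawn_meet[OF L Q edges_disjoint[OF L(1) Q(1) _ single]] LQ by blast
  have LR': "drawn L \<inter> drawn R = {}"
    using drawn_meet[OF L R edges_disjoint[OF L(1) R(1) _ single]] LR by blast
  note loopP = inside_of_arcs[OF gP(1) gR(1) gP(2,3) gR(2,3), unfolded gP(4) gR(4), OF PR']
  note loopQ = inside_of_arcs[OF gQ(1) gR(1) gQ(2,3) gR(2,3), unfolded gQ(4) gR(4), OF QR']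
  have drawP: "drawn P \<union> drawn R \<subseteq> drawing_image G p c" "drawn Q \<union> drawn R \<subseteq> drawing_image G p c"
    using drawn_in_drawing P Q R by blast+
  have pin: "p u \<in> drawn L" "p v \<in> drawn L" using uL by (auto simp: drawn_def)
  have puv: "p u \<noteq> p v" using uv inV inj_p by (auto dest: inj_onD)
  have outP: "drawn L - {p u} \<subseteq> outside (drawn P \<union> drawn R)"
  proof -
    have "p v \<notin> inside (drawn P \<union> drawn R)"
      by (rule vertex_not_inside[OF inV(2) drawP(1) compact_imp_closed[OF loopP(5)]])
    moreover have "drawn L - {p u} \<subseteq> inside (drawn P \<union> drawn R) \<or>
        drawn L - {p u} \<subseteq> outside (drawn P \<union> drawn R)"
      by (rule connected_off_curve[OF _ _ compact_imp_closed[OF loopP(5)]])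
        (use connected_arc_minus_start[OF gL(1)] gL LP' LR' in auto)
    moreover have "p v \<in> drawn L - {p u}" using pin puv by auto
    ultimately show ?thesis by (meson subsetD)
  qed
  have outQ: "drawn L - {p v} \<subseteq> outside (drawn Q \<union> drawn R)"
  proof -
    have "p u \<notin> inside (drawn Q \<union> drawn R)"
      by (rule vertex_not_inside[OF inV(1) drawP(2) compact_imp_closed[OF loopQ(5)]])
    moreover have "drawn L - {p v} \<subseteq> inside (drawn Q \<union> drawn R) \<or>
        drawn L - {p v} \<subseteq> outside (drawn Q \<union> drawn R)"
      by (rule connected_off_curve[OF _ _ compact_imp_closed[OF loopQ(5)]])
        (use connected_arc_minus_finish[OF gL(1)] gL LQ' LR' in auto)
    moreover have "p u \<in> drawn L - {p v}" using pin puv by auto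
    ultimately show ?thesis by (meson subsetD)
  qed
  obtain z where z: "z \<in> drawn L - {p u, p v}"
    using nonempty_simple_path_endless[OF arc_imp_simple_path[OF gL(1)]] gL by auto
  have "topological_space_class.connected ((drawn P \<union> drawn R) \<inter> (drawn Q \<union> drawn R))"
  proof -
    have "{p x, p y} \<subseteq> drawn R" using xy by (auto simp: drawn_def)
    then have "(drawn P \<union> drawn R) \<inter> (drawn Q \<union> drawn R) = drawn R" using PQ' by blast
    then show ?thesis using connected_arc_image[OF gR(1)] gR(4) by simp
  qed
  moreover have "z \<in> outside (drawn P \<union> drawn R)" "z \<in> outside (drawn Q \<union> drawn R)"
    using z outP outQ by auto
  ultimately have "z \<in> outside ((drawn P \<union> drawn R) \<union> (drawn Q \<union> drawn R))"
    by (rule outside_Un[OF loopP(5) loopQ(5) _ loopP(3) loopQ(3)])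
  moreover have "drawn P \<union> drawn Q \<subseteq> (drawn P \<union> drawn R) \<union> (drawn Q \<union> drawn R)" by auto
  ultimately have "z \<in> outside (drawn P \<union> drawn Q)" using outside_mono by (meson subsetD)
  moreover have "z \<in> inside (drawn P \<union> drawn Q)" using L_inside z by blast
  ultimately show False using inside_Int_outside[of "drawn P \<union> drawn Q"] by blast
qed

end

section \<open>Connected sets, components and bonds\<close>

locale sgraph =
  fixes V :: "'a set" and E :: "'a rel"
  assumes finite_V: "finite V"
    and arc_in_V: "(u, v) \<in> E \<Longrightarrow> u \<in> V \<and> v \<in> V"
    and no_loop: "(u, u) \<notin> E"
    and sym_E: "sym E"
begin

text \<open>
  Connectivity of the induced subgraph, by cuts rather than paths: most arguments below cut a
  connected set in two and need an edge across. \<open>conn_reach\<close> and \<open>connI_reach\<close> relate it to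
  reachability.
\<close>

definition conn :: "'a set \<Rightarrow> bool" where
  "conn A \<longleftrightarrow> A \<noteq> {} \<and> (\<forall>B. B \<noteq> {} \<longrightarrow> B \<subset> A \<longrightarrow> (\<exists>b\<in>B. \<exists>a\<in>A - B. (b, a) \<in> E))"

definition nbrs :: "'a set \<Rightarrow> 'a set" where
  "nbrs A = {x \<in> V - A. \<exists>a\<in>A. (a, x) \<in> E}"

text \<open>The component of \<open>u\<close> in the subgraph induced by \<open>B\<close>, empty if \<open>u\<close> is not in \<open>B\<close>.\<close>

definition component :: "'a set \<Rightarrow> 'a \<Rightarrow> 'a set" where
  "component B u = {w. (u, w) \<in> rtrancl_on B E}"

lemma connD: "conn A \<Longrightarrow> B \<noteq> {} \<Longrightarrow> B \<subset> A \<Longrightarrow> \<exists>b\<in>B. \<exists>a\<in>A - B. (b, a) \<in> E"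
  by (auto simp: conn_def)

lemma component_subset: "component B u \<subseteq> B"
  by (auto simp: component_def dest: in_rtrancl_on_in_F)

lemma self_in_component: "u \<in> B \<Longrightarrow> u \<in> component B u"
  by (simp add: component_def)

lemma component_closed: "w \<in> component B u \<Longrightarrow> (w, z) \<in> E \<Longrightarrow> z \<in> B \<Longrightarrow> z \<in> component B u"
  by (auto simp: component_def intro: rtrancl_on_into_rtrancl_on)

lemma conn_subset_component:
  assumes "conn F" "F \<subseteq> B" "u \<in> F"
  shows "F \<subseteq> component B u"
proof (rule ccontr)
  assume "\<not> F \<subseteq> component B u"
  then have "F \<inter> component B u \<subset> F" by auto
  moreover have "F \<inter> component B u \<noteq> {}" using assms self_in_component[of u B] by auto
  ultimately obtain b a where "b \<in> F \<inter> component B u" "a \<in> F - component B u" "(b, a) \<in> E"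
    using connD[OF assms(1), of "F \<inter> component B u"] by auto
  then show False using component_closed assms(2) by blast
qed

lemma conn_reach:
  assumes "conn A" "u \<in> A" "w \<in> A"
  shows "(u, w) \<in> rtrancl_on A E"
  using conn_subset_component[OF assms(1) subset_refl assms(2)] assms(3) by (auto simp: component_def)

lemma connI_reach:
  assumes "u \<in> A" "\<And>w. w \<in> A \<Longrightarrow> (u, w) \<in> rtrancl_on A E"
  shows "conn A"
proof -
  have sym: "sym (rtrancl_on A E)" by (rule rtrancl_on_sym[OF sym_E])
  have "\<exists>b\<in>B. \<exists>a\<in>A - B. (b, a) \<in> E" if B: "B \<noteq> {}" "B \<subset> A" for B
  proof -
    obtain b a where ba: "b \<in> B" "a \<in> A" "a \<notin> B" using B by blast
    then have "(b, a) \<in> rtrancl_on A E"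
      using assms B sym by (meson psubsetD rtrancl_on_trans symD)
    then show ?thesis using ba(1,3)
    proof (induction rule: rtrancl_on_induct)
      case (step y z)
      then show ?case by blast
    qed simp
  qed
  then show ?thesis using assms(1) by (auto simp: conn_def)
qed

lemma conn_component:
  assumes "u \<in> B"
  shows "conn (component B u)"
proof (rule connI_reach)
  show "u \<in> component B u" using assms by (rule self_in_component)
  fix w assume "w \<in> component B u"
  then have "(u, w) \<in> rtrancl_on B E" by (simp add: component_def)
  then show "(u, w) \<in> rtrancl_on (component B u) E"
  proof (induction rule: rtrancl_on_induct)
    case base
    then show ?case using self_in_component[OF assms] by simp
  next
    case (step y z)
    then have "z \<in> component B u" by (auto simp: component_def intro: rtrancl_on_into_rtrancl_on)
    then show ?case using step by (auto intro: rtrancl_on_into_rtrancl_on)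
  qed
qed

lemma conn_Un:
  assumes "conn A" "conn B" "a \<in> A" "b \<in> B" "(a, b) \<in> E"
  shows "conn (A \<union> B)"
proof -
  have ba: "(b, a) \<in> E" using assms(5) sym_E by (auto dest: symD)
  have "\<exists>d\<in>D. \<exists>w\<in>A \<union> B - D. (d, w) \<in> E" if D: "D \<noteq> {}" "D \<subset> A \<union> B" for D
  proof -
    consider "A \<inter> D \<noteq> {}" "A \<inter> D \<subset> A" | "B \<inter> D \<noteq> {}" "B \<inter> D \<subset> B"
      | "A \<subseteq> D" "B \<inter> D = {}" | "B \<subseteq> D" "A \<inter> D = {}"
      using D by blast
    then show ?thesis
    proof cases
      case 1
      then show ?thesis using connD[OF assms(1), of "A \<inter> D"] by blast
    next
      case 2
      then show ?thesis using connD[OF assms(2), of "B \<inter> D"] by blast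
    next
      case 3
      then have "a \<in> D" "b \<in> A \<union> B - D" using assms by auto
      then show ?thesis using assms(5) by blast
    next
      case 4
      then have "b \<in> D" "a \<in> A \<union> B - D" using assms by auto
      then show ?thesis using ba by blast
    qed
  qed
  then show ?thesis using assms(3) by (auto simp: conn_def)
qed

text \<open>
  All the components of \<open>A - {v}\<close> hang on \<open>v\<close>, so that removing one of them leaves the others
  connected through \<open>v\<close>.
\<close>

lemma conn_remove_component:
  assumes "conn A" "v \<in> A"
  shows "conn (A - component (A - {v}) u)"
proof -
  let ?C = "component (A - {v}) u"
  have v: "v \<in> A - ?C" using assms component_subset by fast
  have cut: "\<exists>b\<in>B. \<exists>a\<in>A - ?C - B. (b, a) \<in> E" if B: "v \<in> B" "B \<subset> A - ?C" for B
  proof -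
    have "B \<union> ?C \<subset> A" using B component_subset[of "A - {v}" u] by blast
    then obtain b a where ba: "b \<in> B \<union> ?C" "a \<in> A - (B \<union> ?C)" "(b, a) \<in> E"
      using connD[OF assms(1), of "B \<union> ?C"] B by blast
    have "b \<notin> ?C"
    proof
      assume "b \<in> ?C"
      moreover have "a \<in> A - {v}" using ba B by auto
      ultimately show False using component_closed ba by blast
    qed
    then show ?thesis using ba by blast
  qed
  have "\<exists>b\<in>B. \<exists>a\<in>A - ?C - B. (b, a) \<in> E" if B: "B \<noteq> {}" "B \<subset> A - ?C" for B
  proof (cases "v \<in> B")
    case True
    then show ?thesis using cut B by blast
  next
    case False
    then obtain b a where "b \<in> A - ?C - B" "a \<in> A - ?C - (A - ?C - B)" "(b, a) \<in> E"
      using cut[of "A - ?C - B"] v B by blast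
    then have "a \<in> B" "(a, b) \<in> E" using sym_E by (auto dest: symD)
    then show ?thesis using \<open>b \<in> A - ?C - B\<close> by blast
  qed
  then show ?thesis using v unfolding conn_def by blast
qed

lemma nbrs_component_subset: "nbrs (component (A - {v}) u) \<subseteq> insert v (nbrs A)"
proof
  fix x assume x: "x \<in> nbrs (component (A - {v}) u)"
  then obtain a where a: "a \<in> component (A - {v}) u" "(a, x) \<in> E" "x \<in> V" "x \<notin> component (A - {v}) u"
    by (auto simp: nbrs_def)
  then have "x \<notin> A - {v}" using component_closed by blast
  moreover have "a \<in> A" using a component_subset by fast
  ultimately show "x \<in> insert v (nbrs A)" using a by (auto simp: nbrs_def)
qed

lemma graph_path_of_reach:
  assumes "(u, w) \<in> rtrancl_on B E"
  shows "\<exists>vs. graph_path E u vs w \<and> set vs \<subseteq> B"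
  using assms
proof (induction rule: rtrancl_on_induct)
  case base
  then show ?case by (intro exI[of _ "[u]"]) (auto simp: graph_path_def)
next
  case (step y z)
  then obtain vs where vs: "graph_path E u vs y" "set vs \<subseteq> B" by blast
  show ?case
  proof (cases "z \<in> set vs")
    case True
    then obtain us ws where "vs = us @ z # ws" by (meson split_list)
    then show ?thesis using graph_path_split(1)[of E u us z ws y] vs by (intro exI[of _ "us @ [z]"]) auto
  next
    case False
    then show ?thesis using vs step
      by (intro exI[of _ "vs @ [z]"]) (auto simp: graph_path_def successively_append_iff)
  qed
qed

text \<open>
  In graph theory a bond is a minimal cut, given by a connected set with connected complement.
  Here it is the set itself that is called a bond. The whole vertex set is admitted as the
  starting point of the recursion.
\<close>

definition bond :: "'a set \<Rightarrow> bool" where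
  "bond A \<longleftrightarrow> A \<subseteq> V \<and> conn A \<and> (A = V \<or> conn (V - A)) \<and> card (nbrs A) \<le> 2"

end

section \<open>Splitting a bond at one vertex\<close>

sublocale outer_drawing \<subseteq> sgraph "pverts G" "parcs G"
proof -
  interpret pair_graph G by (rule graph)
  show "sgraph (pverts G) (parcs G)"
    by unfold_locales (use arcs_in_verts no_loop sym_E in auto)
qed

context outer_drawing begin

text \<open>
  The existence of the separating vertex is where the excluded subgraphs enter. Suppose that
  every vertex of \<open>A\<close> can be avoided on the way from \<open>x\<close> to \<open>y\<close> through \<open>A\<close>. Take a shortest
  path \<open>P\<close> of this kind, let \<open>v\<close> be its first vertex in \<open>A\<close>, and follow a path avoiding \<open>v\<close> up
  to its first vertex \<open>t\<close> on the rest of \<open>P\<close>. This ear from \<open>x\<close> to \<open>t\<close> has an interior vertex,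
  for otherwise \<open>P\<close> could be shortened. The complement of \<open>A\<close> contains a path \<open>R\<close> from \<open>x\<close> to
  \<open>y\<close>. If \<open>t \<noteq> y\<close>, then \<open>P\<close> up to \<open>t\<close>, the ear, and \<open>R\<close> followed by \<open>P\<close> backwards from \<open>y\<close> to
  \<open>t\<close> form a theta. If \<open>t = y\<close>, then \<open>P\<close>, the ear, \<open>R\<close> and a path in \<open>A\<close> that links the
  interiors of \<open>P\<close> and of the ear form a subdivision of $K_4$.
\<close>

lemma separating_vertex:
  assumes A: "conn A" "A \<subseteq> V" and out: "conn (V - A)"
    and xy: "x \<noteq> y" "x \<in> V - A" "y \<in> V - A"
  shows "\<exists>v\<in>A. \<forall>u\<in>A - {v}. x \<notin> nbrs (component (A - {v}) u) \<or> y \<notin> nbrs (component (A - {v}) u)"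
proof (rule ccontr)
  assume "\<not> ?thesis"
  then have contr: "\<forall>v\<in>A. \<exists>u\<in>A - {v}.
      x \<in> nbrs (component (A - {v}) u) \<and> y \<in> nbrs (component (A - {v}) u)"
    by simp
  define thru where "thru us \<longleftrightarrow> us \<noteq> [] \<and> set us \<subseteq> A \<and> graph_path E x (x # us @ [y]) y" for us
  have avoid: "\<exists>us. thru us \<and> v \<notin> set us" if v: "v \<in> A" for v
  proof -
    obtain u where u: "x \<in> nbrs (component (A - {v}) u)" "y \<in> nbrs (component (A - {v}) u)"
      using contr v by blast
    then obtain a b where ab: "(a, x) \<in> E" "(b, y) \<in> E"
      "a \<in> component (A - {v}) u" "b \<in> component (A - {v}) u"
      by (auto simp: nbrs_def)
    have "u \<in> A - {v}" using ab(3) by (auto simp: component_def dest: in_rtrancl_on_in_F)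
    then have "(a, b) \<in> rtrancl_on (component (A - {v}) u) E"
      using conn_reach[OF conn_component ab(3,4)] by simp
    then obtain us where us: "graph_path E a us b" "set us \<subseteq> component (A - {v}) u"
      using graph_path_of_reach by blast
    have "set us \<subseteq> A - {v}" using us(2) component_subset by blast
    moreover have "(x, a) \<in> E" using ab(1) sym_E by (auto dest: symD)
    ultimately have "thru us" using us(1) ab xy unfolding thru_def graph_path_def
      by (auto simp: successively_Cons successively_append_iff)
    then show ?thesis using \<open>set us \<subseteq> A - {v}\<close> by blast
  qed
  obtain R where R: "graph_path E x R y" "set R \<subseteq> V - A"
    using graph_path_of_reach[OF conn_reach[OF out xy(2,3)]] by blast
  have "A \<noteq> {}" using A(1) by (simp add: conn_def)
  then have "\<exists>us. thru us" using avoid by blast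
  then obtain us where us: "thru us" "\<And>us'. thru us' \<Longrightarrow> length us \<le> length us'"
    using ex_has_least_nat[of thru _ length] by blast
  then obtain v ws where vws: "us = v # ws" unfolding thru_def by (meson neq_Nil_conv)
  have P: "graph_path E x (x # v # ws @ [y]) y" and vA: "v \<in> A" "set ws \<subseteq> A"
    using us(1) vws by (auto simp: thru_def)
  obtain qs where qs: "thru qs" "v \<notin> set qs" using avoid vA by blast
  have Q: "graph_path E x (x # qs @ [y]) y" and qA: "set qs \<subseteq> A" "qs \<noteq> []"
    using qs by (auto simp: thru_def)
  obtain ms t rest where ms: "qs @ [y] = ms @ t # rest" "t \<in> set (ws @ [y])"
    "\<forall>m\<in>set ms. m \<notin> set (ws @ [y])"
    using split_list_first_prop[of "qs @ [y]" "\<lambda>t. t \<in> set (ws @ [y])"] by auto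
  have msA: "set ms \<subseteq> A"
  proof
    fix m assume "m \<in> set ms"
    then have "m \<in> set (qs @ [y])" "m \<noteq> y" using ms by auto
    then show "m \<in> A" using qA by auto
  qed
  have v_ms: "v \<notin> set ms"
  proof
    assume v: "v \<in> set ms"
    then have "v \<in> set (qs @ [y])" using ms(1) by auto
    then show False using qs(2) v ms(3) by auto
  qed
  have ear: "graph_path E x (x # ms @ [t]) t"
    using graph_path_split(1)[of E x "x # ms" t rest y] Q ms(1) by simp
  show False
  proof (cases "t = y")
    case False
    then obtain w1 w2 where w12: "ws = w1 @ t # w2" using ms(2) by (auto dest: split_list)
    have tA: "t \<in> A" "set w1 \<subseteq> A" "set w2 \<subseteq> A" using vA w12 by auto
    have P1: "graph_path E x (x # v # w1 @ [t]) t" and P2: "graph_path E t (t # w2 @ [y]) y"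
      using graph_path_split[of E x "x # v # w1" t "w2 @ [y]" y] P w12 by simp_all
    have "ms \<noteq> []"
    proof
      assume "ms = []"
      then have xt: "(x, t) \<in> E" using ear by (simp add: graph_path_def)
      then have "thru (t # w2)"
        using P2 tA xy unfolding thru_def graph_path_def by auto
      then have "length us \<le> length (t # w2)" by (rule us(2))
      then show False using vws w12 by simp
    qed
    then obtain m where m: "m \<in> set ms" by (meson list.set_sel(1))
    let ?S = "R @ tl (rev (t # w2 @ [y]))"
    have P2r: "graph_path E y (rev (t # w2 @ [y])) t" by (rule graph_path_rev[OF P2 sym_E])
    have S: "graph_path E x ?S t"
      by (rule graph_path_join[OF R(1) P2r]) (use R(2) tA in auto)
    have setS: "set ?S = set R \<union> insert t (insert y (set w2))"
      using set_join[OF R(1) P2r] by auto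
    have dist: "distinct (x # v # w1 @ t # w2 @ [y])" using P w12 by (simp add: graph_path_def)
    have nx: "x \<notin> set ms" "t \<notin> set ms" using ear by (auto simp: graph_path_def)
    have msw: "set ms \<inter> set w1 = {}" "set ms \<inter> set w2 = {}" using ms(3) w12 by auto
    have S_A: "set ?S \<inter> A \<subseteq> insert t (set w2)" using setS R(2) xy by auto
    show False
    proof (rule no_theta[OF P1 _ ear _ S, of v m y])
      show "set (x # v # w1 @ [t]) \<subseteq> V" "set (x # ms @ [t]) \<subseteq> V" "set ?S \<subseteq> V"
        using vA tA msA A(2) xy R(2) setS by auto
      show "x \<noteq> t" using tA xy by auto
      show "set (x # v # w1 @ [t]) \<inter> set (x # ms @ [t]) \<subseteq> {x, t}"
        using v_ms msw by auto
      show "set (x # v # w1 @ [t]) \<inter> set ?S \<subseteq> {x, t}"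
        using S_A vA tA dist by auto
      show "set (x # ms @ [t]) \<inter> set ?S \<subseteq> {x, t}"
        using S_A msA msw by auto
      show "v \<in> set (x # v # w1 @ [t])" "m \<in> set (x # ms @ [t])" "y \<in> set ?S"
        using m setS by auto
      show "v \<noteq> x" "v \<noteq> t" "m \<noteq> x" "m \<noteq> t" "y \<noteq> x" "y \<noteq> t"
        using dist nx m xy by auto
    qed
  next
    case True
    have "ms \<noteq> []"
    proof
      assume "ms = []"
      then have "y \<in> set qs" using ms(1) True qA(2) by (cases qs) auto
      then show False using qA xy by auto
    qed
    have disj: "set us \<inter> set ms = {}" using ms(3) v_ms vws by auto
    have usA: "set us \<subseteq> A" using vA vws by simp
    obtain m where m: "m \<in> set ms" using \<open>ms \<noteq> []\<close> by (meson list.set_sel(1))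
    \<comment> \<open>Of a path in \<open>A\<close> from \<open>P\<close> to the ear, keep the part up to the first vertex \<open>q\<close> on the
      ear, and of that the part from the last vertex \<open>u\<close> on \<open>P\<close>.\<close>
    obtain L0 where L0: "graph_path E v L0 m" "set L0 \<subseteq> A"
      using graph_path_of_reach[OF conn_reach[OF A(1) vA(1)]] m msA by blast
    have "m \<in> set L0" "v \<in> set L0" using graph_path_ends[OF L0(1)] by auto
    then obtain l1 q l2 where l: "L0 = l1 @ q # l2" "q \<in> set ms" "\<forall>z\<in>set l1. z \<notin> set ms"
      using split_list_first_prop[of L0 "\<lambda>z. z \<in> set ms"] m by blast
    have L1: "graph_path E v (l1 @ [q]) q" using graph_path_split(1)[of E v l1 q l2 m] L0 l by simp
    have "v \<in> set (l1 @ [q])" using graph_path_ends[OF L1] by auto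
    then obtain k1 u k2 where k: "l1 @ [q] = k1 @ u # k2" "u \<in> set us" "\<forall>z\<in>set k2. z \<notin> set us"
      using split_list_last_prop[of "l1 @ [q]" "\<lambda>z. z \<in> set us"] vws by auto
    have L: "graph_path E u (u # k2) q" using graph_path_split(2)[of E v k1 u k2 q] L1 k by simp
    have LA: "set (u # k2) \<subseteq> A"
    proof -
      have "set (u # k2) \<subseteq> set (l1 @ [q])" unfolding k(1) by auto
      then show ?thesis using L0(2) l(1) by auto
    qed
    have Lms: "set (u # k2) \<inter> set ms \<subseteq> {q}"
    proof -
      have "set (u # k2) \<subseteq> set (l1 @ [q])" unfolding k(1) by auto
      then show ?thesis using l(3) by auto
    qed
    obtain p1 p2 where p12: "us = p1 @ u # p2" using k(2) by (meson split_list)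
    obtain m1 m2 where m12: "ms = m1 @ q # m2" using l(2) by (meson split_list)
    show False
    proof (rule no_K4_subdivision[of x "x # p1" u "p2 @ [y]" y "x # m1" q "m2 @ [y]" R "u # k2"])
      have Pe: "(x # p1) @ u # p2 @ [y] = x # us @ [y]" and Qe: "(x # m1) @ q # m2 @ [y] = x # ms @ [y]"
        using p12 m12 by auto
      show "graph_path E x ((x # p1) @ u # p2 @ [y]) y" using P vws unfolding Pe by simp
      show "graph_path E x ((x # m1) @ q # m2 @ [y]) y" using ear True unfolding Qe by simp
      show "set ((x # p1) @ u # p2 @ [y]) \<subseteq> V" unfolding Pe using usA A(2) xy by auto
      show "set ((x # m1) @ q # m2 @ [y]) \<subseteq> V" unfolding Qe using msA A(2) xy by auto
      show "graph_path E x R y" "set R \<subseteq> V" "graph_path E u (u # k2) q" "set (u # k2) \<subseteq> V" "x \<noteq> y"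
        using R L LA A(2) xy by auto
      show "u \<notin> {x, y}" "q \<notin> {x, y}" using k(2) l(2) usA msA xy by auto
      show "set ((x # p1) @ u # p2 @ [y]) \<inter> set ((x # m1) @ q # m2 @ [y]) \<subseteq> {x, y}"
        unfolding Pe Qe using disj usA msA xy by auto
      show "set ((x # p1) @ u # p2 @ [y]) \<inter> set R \<subseteq> {x, y}"
        unfolding Pe using usA R(2) by auto
      show "set ((x # m1) @ q # m2 @ [y]) \<inter> set R \<subseteq> {x, y}"
        unfolding Qe using msA R(2) by auto
      show "set (u # k2) \<inter> set ((x # p1) @ u # p2 @ [y]) \<subseteq> {u}"
        unfolding Pe using LA k(3) xy by auto
      show "set (u # k2) \<inter> set ((x # m1) @ q # m2 @ [y]) \<subseteq> {q}"
        unfolding Qe using LA Lms xy by auto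
      show "set (u # k2) \<inter> set R = {}" using LA R(2) by auto
    qed
  qed
qed

text \<open>
  A component \<open>C\<close> of \<open>A - {v}\<close> has its neighbours among \<open>v\<close> and those of \<open>A\<close>. So \<open>v\<close> has to keep
  two neighbours of \<open>A\<close> apart; it must also leave some vertex of \<open>A - C\<close> with a neighbour
  outside \<open>A\<close>, to make the complement of \<open>C\<close> connected.
\<close>

lemma bond_split:
  assumes "conn V" "bond A"
  shows "\<exists>v\<in>A. \<forall>u\<in>A - {v}. bond (component (A - {v}) u)"
proof -
  have A: "A \<subseteq> V" "conn A" "A = V \<or> conn (V - A)" "card (nbrs A) \<le> 2" "A \<noteq> {}"
    using assms(2) by (auto simp: bond_def conn_def)
  have fin: "finite (nbrs B)" for B using finite_V by (auto simp: nbrs_def)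
  have bondI: "bond (component (A - {v}) u)"
    if v: "v \<in> A" and u: "u \<in> A - {v}"
      and card: "card (insert v (nbrs A) \<inter> nbrs (component (A - {v}) u)) \<le> 2"
      and adj: "A = V \<or> (\<exists>w\<in>A - component (A - {v}) u. \<exists>x\<in>V - A. (w, x) \<in> E)" for u v
  proof -
    let ?C = "component (A - {v}) u"
    have sub: "?C \<subseteq> A" using component_subset by blast
    have AC: "conn (A - ?C)" using conn_remove_component A(2) v by blast
    have "conn (V - ?C)"
    proof (cases "A = V")
      case False
      then obtain w x where "w \<in> A - ?C" "x \<in> V - A" "(w, x) \<in> E" using adj by blast
      then have "conn ((A - ?C) \<union> (V - A))" using conn_Un[OF AC] A(3) False by blast
      moreover have "(A - ?C) \<union> (V - A) = V - ?C" using sub A(1) by blast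
      ultimately show ?thesis by simp
    qed (use AC in simp)
    moreover have "nbrs ?C = insert v (nbrs A) \<inter> nbrs ?C" using nbrs_component_subset by blast
    ultimately show ?thesis using card conn_component[OF u] sub A(1) unfolding bond_def by auto
  qed
  have "card (nbrs A) = 0 \<or> card (nbrs A) = 1 \<or> card (nbrs A) = 2" using A(4) by linarith
  then consider "nbrs A = {}" | x where "nbrs A = {x}" | x y where "nbrs A = {x, y}" "x \<noteq> y"
    using fin[of A] by (auto simp: card_1_singleton_iff card_2_iff)
  then show ?thesis
  proof cases
    case 1
    have "A = V"
    proof (rule ccontr)
      assume "A \<noteq> V"
      then have "\<exists>b\<in>A. \<exists>a\<in>V - A. (b, a) \<in> E" using connD[OF assms(1)] A(1,5) by blast
      then show False using 1 by (auto simp: nbrs_def)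
    qed
    obtain v where v: "v \<in> A" using A(5) by blast
    have "card (insert v (nbrs A) \<inter> S) \<le> 2" for S
      using card_mono[of "{v}" "{v} \<inter> S"] 1 by simp
    then show ?thesis using v \<open>A = V\<close> by (intro bexI[of _ v] ballI bondI) auto
  next
    case (2 x)
    then obtain v where v: "v \<in> A" "(v, x) \<in> E" "x \<in> V - A" by (auto simp: nbrs_def)
    have "card (insert v (nbrs A) \<inter> S) \<le> 2" for S
    proof -
      have "card (insert v (nbrs A) \<inter> S) \<le> card {v, x}" using 2 by (intro card_mono) auto
      also have "\<dots> \<le> 2" by (simp add: card_insert_if)
      finally show ?thesis .
    qed
    moreover have "v \<in> A - component (A - {v}) u" for u using v component_subset by fast
    ultimately show ?thesis using v by (intro bexI[of _ v] ballI bondI) blast+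
  next
    case (3 x y)
    then have xy: "x \<in> V - A" "y \<in> V - A" by (auto simp: nbrs_def)
    then have "conn (V - A)" using A(3) by auto
    then obtain v where v: "v \<in> A"
      and sep: "\<And>u. u \<in> A - {v} \<Longrightarrow> x \<notin> nbrs (component (A - {v}) u) \<or> y \<notin> nbrs (component (A - {v}) u)"
      using separating_vertex[OF A(2,1) _ 3(2) xy] by blast
    show ?thesis
    proof (intro bexI[of _ v] ballI bondI v)
      fix u assume u: "u \<in> A - {v}"
      let ?C = "component (A - {v}) u"
      obtain z where z: "z \<in> {x, y}" "z \<notin> nbrs ?C" using sep[OF u] by blast
      have "card (insert v (nbrs A) \<inter> nbrs ?C) \<le> card (insert v ({x, y} - {z}))"
        using 3 z by (intro card_mono) auto
      also have "\<dots> \<le> 2" using z(1) 3(2) by (auto simp: card_insert_if)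
      finally show "card (insert v (nbrs A) \<inter> nbrs ?C) \<le> 2" .
      have "z \<in> nbrs A" using z(1) 3(1) by auto
      then obtain w where w: "w \<in> A" "(w, z) \<in> E" "z \<in> V - A" by (auto simp: nbrs_def)
      have "?C \<subseteq> A" using component_subset by blast
      then have "w \<notin> ?C" using w z(2) by (auto simp: nbrs_def)
      then show "A = V \<or> (\<exists>w\<in>A - ?C. \<exists>x\<in>V - A. (w, x) \<in> E)" using w by blast
    qed auto
  qed
qed

end

section \<open>Counting edges and packing eggs\<close>

text \<open>
  All that matters from here on is that every bond splits at some vertex into bonds. This holds
  in all connected graphs without a subdivision of $K_{2,3}$ or $K_4$.
\<close>

locale bond_graph = sgraph +
  assumes conn_V: "conn V"
    and bond_split: "bond A \<Longrightarrow> \<exists>v\<in>A. \<forall>u\<in>A - {v}. bond (component (A - {v}) u)"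
begin

lemma bond_V: "bond V"
  using conn_V by (auto simp: bond_def nbrs_def)

lemma component_eq:
  assumes "w \<in> component B u"
  shows "component B w = component B u"
proof -
  have uw: "(u, w) \<in> rtrancl_on B E" using assms by (simp add: component_def)
  then have "(w, u) \<in> rtrancl_on B E" using rtrancl_on_sym[OF sym_E] by (metis symD)
  then show ?thesis using uw by (auto simp: component_def intro: rtrancl_on_trans)
qed

definition touching :: "'a set \<Rightarrow> 'a set set" where
  "touching A = {{u, v} | u v. (u, v) \<in> E \<and> u \<in> A}"

lemma finite_touching: "finite (touching A)"
proof (rule finite_subset)
  show "touching A \<subseteq> Pow V" using arc_in_V by (auto simp: touching_def)
  show "finite (Pow V)" using finite_V by simp
qed

text \<open>
  Removing the splitting vertex \<open>v\<close> leaves smaller bonds. Every edge that meets \<open>A\<close> meets one of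
  them, except for the at most two edges from \<open>v\<close> to the neighbours of \<open>A\<close>.
\<close>

lemma card_touching: "bond A \<Longrightarrow> card (touching A) \<le> 2 * card A"
proof (induction "card A" arbitrary: A rule: less_induct)
  case less
  then have A: "A \<subseteq> V" "card (nbrs A) \<le> 2" by (auto simp: bond_def)
  have finA: "finite A" using A(1) finite_V finite_subset by blast
  obtain v where v: "v \<in> A" and split: "\<forall>u\<in>A - {v}. bond (component (A - {v}) u)"
    using bond_split less.prems by blast
  let ?B = "A - {v}"
  let ?P = "component ?B ` ?B"
  have finP: "finite ?P" using finA by simp
  have finC: "finite C" if "C \<in> ?P" for C
  proof -
    have "C \<subseteq> A" using that component_subset by blast
    then show ?thesis using finA by (rule finite_subset)
  qed
  have union: "\<Union>?P = ?B"
  proof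
    show "\<Union>?P \<subseteq> ?B" by (intro UN_least component_subset)
    show "?B \<subseteq> \<Union>?P"
    proof
      fix u assume u: "u \<in> ?B"
      then show "u \<in> \<Union>?P" by (intro UN_I[OF u] self_in_component)
    qed
  qed
  have disj: "disjnt C D" if CD: "C \<in> ?P" "D \<in> ?P" "C \<noteq> D" for C D
  proof -
    obtain c d where cd: "C = component ?B c" "D = component ?B d" using CD(1,2) by (elim imageE)
    have "w \<notin> D" if "w \<in> C" for w
    proof
      assume "w \<in> D"
      then have "component ?B w = D" using component_eq[of w ?B d] unfolding cd by simp
      moreover have "component ?B w = C" using component_eq[of w ?B c] that unfolding cd by simp
      ultimately show False using CD(3) by simp
    qed
    then show ?thesis unfolding disjnt_iff by blast
  qed
  have "card (touching C) \<le> 2 * card C" if "C \<in> ?P" for C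
  proof (rule less.hyps)
    have "C \<subset> A" using that v component_subset by blast
    then show "card C < card A" using finA psubset_card_mono by blast
    show "bond C" using that split by auto
  qed
  then have "(\<Sum>C\<in>?P. card (touching C)) \<le> (\<Sum>C\<in>?P. 2 * card C)" by (rule sum_mono)
  also have "\<dots> = 2 * card ?B"
    using card_Union_disjoint[of ?P] disj finC union
    by (simp add: sum_distrib_left[symmetric] pairwise_def)
  finally have sum: "(\<Sum>C\<in>?P. card (touching C)) \<le> 2 * card ?B" .
  let ?N = "(\<lambda>x. {v, x}) ` nbrs A"
  have finN: "finite (nbrs A)" using finite_V by (auto simp: nbrs_def)
  have sub: "touching A \<subseteq> (\<Union>C\<in>?P. touching C) \<union> ?N"
  proof
    fix e assume "e \<in> touching A"
    then obtain u w where uw: "e = {u, w}" "(u, w) \<in> E" "u \<in> A" by (auto simp: touching_def)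
    have wu: "(w, u) \<in> E" "e = {w, u}" using uw sym_E by (auto dest: symD)
    have *: "e \<in> (\<Union>C\<in>?P. touching C)" if "a \<in> ?B" "e = {a, b}" "(a, b) \<in> E" for a b
    proof -
      have "e \<in> touching (component ?B a)"
        using that self_in_component[of a ?B] unfolding touching_def by blast
      then show ?thesis using that(1) by blast
    qed
    show "e \<in> (\<Union>C\<in>?P. touching C) \<union> ?N"
    proof (cases "u = v")
      case False
      then show ?thesis using * uw by blast
    next
      case True
      then have "w \<noteq> v" using uw no_loop by auto
      show ?thesis
      proof (cases "w \<in> A")
        case True
        then show ?thesis using *[of w u] wu \<open>w \<noteq> v\<close> by blast
      next
        case False
        then have "w \<in> nbrs A" using uw arc_in_V by (auto simp: nbrs_def)
        then show ?thesis using uw True by blast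
      qed
    qed
  qed
  have "card (touching A) \<le> card ((\<Union>C\<in>?P. touching C) \<union> ?N)"
    by (rule card_mono[OF _ sub]) (use finA finN finite_touching in auto)
  also have "\<dots> \<le> card (\<Union>C\<in>?P. touching C) + card ?N" by (rule card_Un_le)
  also have "\<dots> \<le> (\<Sum>C\<in>?P. card (touching C)) + card (nbrs A)"
    by (intro add_mono card_UN_le card_image_le finP finN)
  also have "\<dots> \<le> 2 * card ?B + 2" using sum A(2) by linarith
  also have "\<dots> = 2 * card A"
  proof -
    have "card A > 0" using v finA card_gt_0_iff by blast
    then show ?thesis using v finA by (simp add: card_Diff_singleton)
  qed
  finally show ?case .
qed

definition apart :: "'a set \<Rightarrow> 'a set \<Rightarrow> bool" where
  "apart F F' \<longleftrightarrow> F \<inter> F' = {} \<and> F \<times> F' \<inter> E = {}"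

lemma apart_sym: "apart F F' \<Longrightarrow> apart F' F"
  using sym_E by (auto simp: apart_def dest: symD)

text \<open>
  Hitting and packing connected sets, within a factor of three. In a minimal bond \<open>A\<close> that
  contains a member of the family, the splitting vertex \<open>v\<close> hits all members contained in \<open>A\<close>.
  Adding the at most two neighbours of \<open>A\<close> hits all members that meet \<open>A\<close> and leave it. So three
  vertices hit everything but the members apart from \<open>A\<close>, to which the induction hypothesis
  applies.
\<close>

lemma hitting_packing:
  assumes "finite \<F>" "\<And>F. F \<in> \<F> \<Longrightarrow> conn F \<and> F \<subseteq> V"
  shows "\<exists>X \<P>. X \<subseteq> V \<and> (\<forall>F\<in>\<F>. X \<inter> F \<noteq> {}) \<and>
    \<P> \<subseteq> \<F> \<and> pairwise apart \<P> \<and> card X \<le> 3 * card \<P>"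
  using assms
proof (induction "card \<F>" arbitrary: \<F> rule: less_induct)
  case less
  show ?case
  proof (cases "\<F> = {}")
    case True
    then show ?thesis by (intro exI[of _ "{}"]) auto
  next
    case False
    define good where "good A \<longleftrightarrow> bond A \<and> (\<exists>F\<in>\<F>. F \<subseteq> A)" for A
    have "good V" using False less.prems bond_V by (auto simp: good_def)
    then obtain A where A: "good A" and min: "\<And>B. good B \<Longrightarrow> card A \<le> card B"
      using ex_has_least_nat[of good V card] by blast
    have bA: "bond A" "A \<subseteq> V" "card (nbrs A) \<le> 2" using A by (auto simp: good_def bond_def)
    have finA: "finite A" using bA finite_V finite_subset by blast
    obtain v where v: "v \<in> A" and split: "\<forall>u\<in>A - {v}. bond (component (A - {v}) u)"
      using bond_split bA by blast
    have v_hits: "v \<in> F" if F: "F \<in> \<F>" "F \<subseteq> A" for F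
    proof (rule ccontr)
      assume "v \<notin> F"
      then have sub: "F \<subseteq> A - {v}" using F by auto
      have "conn F" using F less.prems by blast
      then obtain u where u: "u \<in> F" by (auto simp: conn_def)
      then have "good (component (A - {v}) u)"
        using conn_subset_component[OF \<open>conn F\<close> sub u] split sub F(1) unfolding good_def by blast
      then have "card A \<le> card (component (A - {v}) u)" by (rule min)
      moreover have "component (A - {v}) u \<subset> A" using v component_subset by blast
      ultimately show False using finA psubset_card_mono by (metis leD)
    qed
    let ?Y = "insert v (nbrs A)"
    let ?G = "{F \<in> \<F>. ?Y \<inter> F = {}}"
    have away: "A \<inter> F = {} \<and> A \<times> F \<inter> E = {}" if F: "F \<in> ?G" for F
    proof -
      have cF: "conn F" "F \<subseteq> V" using F less.prems by auto
      have notsub: "\<not> F \<subseteq> A" using F v_hits by auto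
      have step: "z \<in> A" if "a \<in> A" "z \<in> F" "(a, z) \<in> E" for a z
        using that F cF by (auto simp: nbrs_def)
      have "A \<inter> F = {}"
      proof (rule ccontr)
        assume "A \<inter> F \<noteq> {}"
        then obtain b a where "b \<in> A \<inter> F" "a \<in> F - A" "(b, a) \<in> E"
          using connD[OF cF(1), of "A \<inter> F"] notsub by blast
        then show False using step by blast
      qed
      then show ?thesis using step by blast
    qed
    obtain F0 where F0: "F0 \<in> \<F>" "F0 \<subseteq> A" using A by (auto simp: good_def)
    have "F0 \<notin> ?G" using v_hits F0 by auto
    then have "card ?G < card \<F>" using F0 less.prems(1) by (intro psubset_card_mono) auto
    then obtain X \<P> where IH: "X \<subseteq> V" "\<forall>F\<in>?G. X \<inter> F \<noteq> {}" "\<P> \<subseteq> ?G" "pairwise apart \<P>"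
      "card X \<le> 3 * card \<P>"
      using less.hyps[of ?G] less.prems by auto
    have "card ?Y \<le> 3" using bA(3) card_insert_le_m1[of 3 "nbrs A" v] by simp
    show ?thesis
    proof (intro exI[of _ "X \<union> ?Y"] exI[of _ "insert F0 \<P>"] conjI)
      show "X \<union> ?Y \<subseteq> V" using IH(1) v bA(2) by (auto simp: nbrs_def)
      show "\<forall>F\<in>\<F>. (X \<union> ?Y) \<inter> F \<noteq> {}" using IH(2) by blast
      show "insert F0 \<P> \<subseteq> \<F>" using F0 IH(3) by auto
      have "apart F0 F" if "F \<in> \<P>" for F
        using away[of F] IH(3) that F0(2) unfolding apart_def by blast
      then show "pairwise apart (insert F0 \<P>)"
        using IH(4) apart_sym by (auto simp: pairwise_insert)
      have "finite \<P>" "F0 \<notin> \<P>" using IH(3) less.prems(1) \<open>F0 \<notin> ?G\<close> by (auto intro: finite_subset)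
      then have "card (insert F0 \<P>) = Suc (card \<P>)" by simp
      then show "card (X \<union> ?Y) \<le> 3 * card (insert F0 \<P>)"
        using card_Un_le[of X ?Y] IH(5) \<open>card ?Y \<le> 3\<close> by linarith
    qed
  qed
qed

end

section \<open>The bound on the scramble number\<close>

lemma (in sgraph) conn_of_connected_subgraph:
  assumes "Digraph_Component.connected (with_proj H)" "parcs H \<subseteq> E"
  shows "conn (pverts H)"
proof -
  have ne: "pverts H \<noteq> {}" and reach: "\<And>u w. u \<in> pverts H \<Longrightarrow> w \<in> pverts H \<Longrightarrow>
      (u, w) \<in> rtrancl_on (pverts H) (parcs (mk_symmetric (with_proj H)))"
    using assms(1) by (auto simp: Digraph_Component.connected_def strongly_connected_def reachable_def)
  have "parcs (mk_symmetric (with_proj H)) \<subseteq> E"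
    using assms(2) sym_E by (auto simp: parcs_mk_symmetric dest: symD)
  moreover obtain u where "u \<in> pverts H" using ne by blast
  ultimately show ?thesis using reach by (intro connI_reach[of u]) (auto intro: rtrancl_on_mono)
qed

lemma scramble_order_le_card_hitting_set:
  assumes "pair_graph G" "hitting_set G S X"
  shows "scramble_order G S \<le> card X"
proof -
  have "enat (scramble_order G S) \<le> enat (hitting_size G S)" by (simp add: enat_scramble_order)
  moreover have "hitting_size G S \<le> card X"
    unfolding hitting_size_def using finite_hitting_sets[OF assms(1)] assms(2) by (intro Min_le) auto
  ultimately show ?thesis by simp
qed

lemma scramble_order_le_card_egg_cut:
  assumes "C \<in> egg_cuts G S"
  shows "scramble_order G S \<le> card C"
proof -
  have "enat (scramble_order G S) \<le> egg_cut_size G S" by (simp add: enat_scramble_order)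
  also have "\<dots> \<le> enat (card C)" unfolding egg_cut_size_def using assms by (rule INF_lower)
  finally show ?thesis by simp
qed

text \<open>
  With \<open>p\<close> eggs pairwise apart and a hitting set of at most \<open>3p\<close> vertices, the order \<open>k\<close> is at
  most \<open>3p\<close>. If \<open>p \<ge> 2\<close>, the edges leaving any of these eggs form an egg-cut, and the \<open>p\<close>
  egg-cuts are disjoint. Hence \<open>p k \<le> 2n\<close>, the bound on the number of edges, and \<open>k\<^sup>2 \<le> 3p k \<le>
  6n\<close>.
\<close>

lemma scramble_order_bound:
  assumes G: "pair_graph G" and BG: "bond_graph (pverts G) (parcs G)" and S: "scramble G S"
  shows "scramble_order G S \<le> 3 \<or> (scramble_order G S)\<^sup>2 \<le> 6 * card (pverts G)"
proof -
  interpret bond_graph "pverts G" "parcs G" by (rule BG)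
  let ?k = "scramble_order G S"
  let ?F = "pverts ` S"
  have eggs: "conn (pverts H) \<and> pverts H \<subseteq> pverts G" if "H \<in> S" for H
    using S that conn_of_connected_subgraph[of H] by (auto simp: scramble_def egg_def subgraph_def)
  have "finite ?F"
  proof (rule finite_subset)
    show "?F \<subseteq> Pow (pverts G)" using eggs by auto
    show "finite (Pow (pverts G))" using finite_V by simp
  qed
  then have "\<exists>X \<P>. X \<subseteq> pverts G \<and> (\<forall>F\<in>?F. X \<inter> F \<noteq> {}) \<and>
      \<P> \<subseteq> ?F \<and> pairwise apart \<P> \<and> card X \<le> 3 * card \<P>"
    by (rule hitting_packing) (use eggs in blast)
  then obtain X \<P> where X: "X \<subseteq> pverts G" "\<forall>F\<in>?F. X \<inter> F \<noteq> {}"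
    and P: "\<P> \<subseteq> ?F" "pairwise apart \<P>" and card: "card X \<le> 3 * card \<P>"
    by blast
  have "hitting_set G S X" using X by (auto simp: hitting_set_def)
  then have k3: "?k \<le> 3 * card \<P>"
    using scramble_order_le_card_hitting_set[OF G] card by (meson le_trans)
  have finP: "finite \<P>" using P(1) \<open>finite ?F\<close> finite_subset by blast
  show ?thesis
  proof (cases "card \<P> \<le> 1")
    case True
    then show ?thesis using k3 by linarith
  next
    case False
    let ?cut = "\<lambda>F. edge_cut G F (pverts G - F)"
    have touching_V: "touching (pverts G) = edges G"
      using arc_in_V by (auto simp: touching_def edges_def)
    have fin_cut: "finite (?cut F)" for F
      using finite_touching[of "pverts G"] touching_V by (auto simp: edge_cut_def)
    have big: "?k \<le> card (?cut F)" if F: "F \<in> \<P>" for F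
    proof -
      obtain F' where F': "F' \<in> \<P>" "F' \<noteq> F"
        using False F finP by (metis card_le_Suc0_iff_eq One_nat_def)
      then have "F \<inter> F' = {}" using P(2) F by (auto simp: pairwise_def apart_def)
      moreover obtain H H' where "H \<in> S" "F = pverts H" "H' \<in> S" "F' = pverts H'"
        using F F' P(1) by blast
      moreover have "F \<subseteq> pverts G" "F' \<subseteq> pverts G" using F F' P(1) eggs by auto
      ultimately have "?cut F \<in> egg_cuts G S"
        unfolding egg_cuts_def by blast
      then show ?thesis by (rule scramble_order_le_card_egg_cut)
    qed
    have disj: "?cut F \<inter> ?cut F' = {}" if FF: "F \<in> \<P>" "F' \<in> \<P>" "F \<noteq> F'" for F F'
    proof (rule ccontr)
      assume "?cut F \<inter> ?cut F' \<noteq> {}"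
      then obtain e where e: "e \<in> ?cut F" "e \<in> ?cut F'" by blast
      have ap: "F \<inter> F' = {}" "F \<times> F' \<inter> parcs G = {}" using P(2) FF by (auto simp: pairwise_def apart_def)
      obtain a b a' b' where ab: "e = {a, b}" "a \<in> F" "e = {a', b'}" "a' \<in> F'" "e \<in> edges G"
        using e unfolding edge_cut_def by blast
      then have "a \<noteq> a'" using ap by auto
      then have "e = {a, a'}" using ab by (auto simp: doubleton_eq_iff)
      moreover obtain u w where "e = {u, w}" "(u, w) \<in> parcs G" using ab(5) by (auto simp: edges_def)
      ultimately have "(a, a') \<in> parcs G" using sym_E by (auto simp: doubleton_eq_iff dest: symD)
      then show False using ap ab by blast
    qed
    have "card \<P> * ?k = (\<Sum>F\<in>\<P>. ?k)" by simp
    also have "\<dots> \<le> (\<Sum>F\<in>\<P>. card (?cut F))" by (intro sum_mono big)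
    also have "\<dots> = card (\<Union>F\<in>\<P>. ?cut F)"
      using finP fin_cut disj by (intro card_UN_disjoint[symmetric]) auto
    also have "\<dots> \<le> card (touching (pverts G))"
      by (intro card_mono finite_touching) (auto simp: touching_V edge_cut_def)
    also have "\<dots> \<le> 2 * card (pverts G)" by (rule card_touching[OF bond_V])
    finally have "card \<P> * ?k \<le> 2 * card (pverts G)" .
    moreover have "?k * ?k \<le> 3 * card \<P> * ?k" using k3 by (intro mult_right_mono) auto
    moreover have "3 * card \<P> * ?k = 3 * (card \<P> * ?k)" by simp
    ultimately have "?k * ?k \<le> 6 * card (pverts G)" by linarith
    then show ?thesis by (simp add: power2_eq_square)
  qed
qed

theorem theorem1p1:
  fixes G :: "'a pair_pre_digraph" and n :: nat
  assumes "pair_graph G"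
    and "Digraph_Component.connected (with_proj G)"
    and "outerplanar G"
    and "card (pverts G) = n"
  shows "real (scramble_number G) \<le> (2 + sqrt 2) * sqrt (real n) + 4"
proof -
  obtain p c where pc: "drawing_in_plane G p c" "p ` pverts G \<subseteq> frontier (outside (drawing_image G p c))"
    using assms(3) by (auto simp: outerplanar_def)
  interpret outer_drawing G p c by (rule outer_drawing.intro[OF assms(1) pc])
  have "conn (pverts G)" using conn_of_connected_subgraph[OF assms(2)] by simp
  then have BG: "bond_graph (pverts G) (parcs G)"
    using bond_split by (intro bond_graph.intro bond_graph_axioms.intro sgraph_axioms)
  have "scramble_number G \<in> scramble_order G ` {S. scramble G S}"
    unfolding scramble_number_def using finite_scrambles[OF assms(1)] scramble_empty by (intro Max_in) auto
  then obtain S where S: "scramble G S" "scramble_number G = scramble_order G S" by blast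
  let ?k = "real (scramble_number G)"
  have pos: "0 \<le> (2 + sqrt 2) * sqrt (real n)" by simp
  consider "scramble_number G \<le> 3" | "(scramble_number G)\<^sup>2 \<le> 6 * n"
    using scramble_order_bound[OF assms(1) BG S(1)] S(2) assms(4) by auto
  then show ?thesis
  proof cases
    case 1
    then show ?thesis using pos by linarith
  next
    case 2
    have "?k\<^sup>2 \<le> 6 * real n" using 2 by (metis of_nat_le_iff of_nat_mult of_nat_numeral of_nat_power)
    also have "\<dots> \<le> (2 + sqrt 2)\<^sup>2 * real n"
      by (intro mult_right_mono) (auto simp: power2_sum)
    also have "\<dots> = ((2 + sqrt 2) * sqrt (real n))\<^sup>2" by (simp add: power_mult_distrib)
    finally have "?k \<le> (2 + sqrt 2) * sqrt (real n)" using pos by (rule power2_le_imp_le)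
    then show ?thesis by simp
  qed
qed

end
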